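(* For $1\le i<j<k<l\le n$, $$\chi^{\langle i\overset{a}{\frown}k\rangle_n}\otimes\chi^{\langle i\overset{b}{\frown}l\rangle_n}=\mathrm{SinfRes}_{U_{[i+1,l]}}^{U_n}\big(\chi^{\langle i\overset{a}{\frown}k\rangle_n}\big)\otimes\chi^{\langle i\overset{b}{\frown}l\rangle_n},\qquad a,b\in\mathbb{F}_q^\times,$$ $$\chi^{\langle i\overset{a}{\frown}l\rangle_n}\otimes\chi^{\langle j\overset{b}{\frown}l\rangle_n}=\chi^{\langle i\overset{a}{\frown}l\rangle_n}\otimes\mathrm{SinfRes}_{U_{[i,l-1]}}^{U_n}\big(\chi^{\langle j\overset{b}{\frown}l\rangle_n}\big),\qquad a,b\in\mathbb{F}_q^\times,$$ $$\chi^{\langle i\overset{a}{\frown}l\rangle_n}\otimes\chi^{\langle i\overset{-a}{\frown}l\rangle_n}=\mathrm{SinfRes}_{U_{[i+1,l]}}^{U_n}\big(\chi^{\langle i\overset{a}{\frown}l\rangle_n}\big)\otimes\mathrm{SinfRes}_{U_{[i,l-1]}}^{U_n}\big(\chi^{\langle i\overset{-a}{\frown}l\rangle_n}\big),\qquad a\in\mathbb{F}_q^\times,$$ $$\chi^{\langle i\overset{a}{\frown}l\rangle_n}\otimes\chi^{\langle i\overset{b}{\frown}l\rangle_n}=\chi^{\langle i\overset{a+b}{\frown}l\rangle_n}\otimes\mathrm{SinfRes}_{U_{[i+1,l-1]}}^{U_n}\big(\chi^{\langle i\overset{a+b}{\frown}l\rangle_n}\big),\qquad a,b\in\mathbb{F}_q^\times,\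 b\ne-a.$$
   Context: Let $q$ be a power of a prime and $U_n=U_n(q)$ the group of $n\times n$ unipotent upper-triangular matrices over $\mathbb{F}_q$. Fix a nontrivial homomorphism $\vartheta:\mathbb{F}_q^+\to\mathbb{C}^\times$. For $S\subseteq\{1,\ldots,n\}$ let $U_S=\{u\in U_n\mid\text{for }i<j,\ u_{ij}\ne0\text{ implies }i,j\in S\}$ and $\mathfrak n_S=U_S-1$. Write $[i,l]=\{i,i+1,\ldots,l\}$ and $\mathfrak n_n=\mathfrak n_{[1,n]}$. $U_S$ acts on the dual space $\mathfrak n_S^*$ by $(g\lambda)(X)=\lambda(g^{-1}X)$ and $(\lambda g)(X)=\lambda(Xg^{-1})$. For $\lambda\in\mathfrak n_S^*$ the supercharacter $\chi^\lambda$ of $U_S$ is $\chi^\lambda(u)=\frac{|\lambda U_S|}{|U_S\lambda U_S|}\sum_{\mu\in U_S\lambda U_S}\vartheta(\mu(u-1))$. The supercharacters form a basis of the space of superclass functions of $U_S$, i.e. functions constant on the superclasses $1+U_SXU_S$, $X\in\mathfrak n_S$. The restriction of a superclass function of $U_n$ to $U_S$ is a superclass function of $U_S$. $\langle i\overset{a}{\frown}l\rangle_n$ denotes the $\mathbb{F}_q$-labeled set-partition of $\{1,\ldots,n\}$ whose only arc joins $i$ to $l$ with label $a\in\mathbb{F}_q^\times$; it is identified with the functional $X\mapsto aX_{il}$ on $\mathfrak n_n$, so $\chi^{\langle i\overset{a}{\frown}l\rangle_n}$ is a supercharacter of $U_n$. Superinflation $\mathrm{Sinf}_{U_S}^{U_n}$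 is the linear map from superclass functions of $U_S$ to superclass functions of $U_n$ given by $\chi^\mu\mapsto\chi^{\mu\circ\pi}$ for $\mu\in\mathfrak n_S^*$, where $\pi:\mathfrak n_n\to\mathfrak n_S$ is the projection which sets to zero all matrix entries in positions $(i,j)$ with $i\notin S$ or $j\notin S$. For a superclass function $\chi$ of $U_n$, $\mathrm{SinfRes}_{U_S}^{U_n}(\chi)=\mathrm{Sinf}_{U_S}^{U_n}(\mathrm{Res}_{U_S}^{U_n}(\chi))$. $\otimes$ is the pointwise product of functions on $U_n$. *)

theory Defs
  imports "HOL-Analysis.Analysis"
begin

text \<open>
  Matrices are indexed by a finite linearly ordered type \<open>'n\<close>, which plays the role of
  $\{1,\ldots,n\}$ with $n = $ \<open>CARD('n)\<close>; the field with $q = $ \<open>CARD('a)\<close> elements is a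
  finite field type \<open>'a\<close>. The group $U_n$ is \<open>UT UNIV\<close>, and $[i,l]$, $[i+1,l]$, $[i,l-1]$,
  $[i+1,l-1]$ are \<open>{i..l}\<close>, \<open>{i<..l}\<close>, \<open>{i..<l}\<close>, \<open>{i<..<l}\<close>.

  Functions on a group \<open>UT S\<close> and functionals on an algebra \<open>nil_alg S\<close> are represented by
  extensional functions (in the sense of \<^theory>\<open>HOL-Library.FuncSet\<close>), so that equality of the
  HOL functions is equality on the domain and orbits of functionals have the right cardinality.
\<close>

type_synonym ('a, 'n) sqmat = "'a ^ 'n ^ 'n"

definition UT :: "'n set \<Rightarrow> ('a::{field,finite}, 'n::{finite,linorder}) sqmat set" where
  "UT S = {u. (\<forall>i. u $ i $ i = 1) \<and> (\<forall>i j. j < i \<longrightarrow> u $ i $ j = 0) \<and>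
             (\<forall>i j. i < j \<longrightarrow> u $ i $ j \<noteq> 0 \<longrightarrow> i \<in> S \<and> j \<in> S)}"

definition nil_alg :: "'n set \<Rightarrow> ('a::{field,finite}, 'n::{finite,linorder}) sqmat set" where
  "nil_alg S = (\<lambda>u. u - mat 1) ` UT S"

definition dual ::
  "'n set \<Rightarrow> (('a::{field,finite}, 'n::{finite,linorder}) sqmat \<Rightarrow> 'a) set" where
  "dual S = {\<eta> \<in> extensional (nil_alg S).
     (\<forall>X \<in> nil_alg S. \<forall>Y \<in> nil_alg S. \<eta> (X + Y) = \<eta> X + \<eta> Y) \<and>
     (\<forall>c. \<forall>X \<in> nil_alg S. \<eta> (map_matrix ((*) c) X) = c * \<eta> X)}"

definition left_act :: "'n set \<Rightarrow> ('a::{field,finite}, 'n::{finite,linorder}) sqmat \<Rightarrow>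
    (('a, 'n) sqmat \<Rightarrow> 'a) \<Rightarrow> ('a, 'n) sqmat \<Rightarrow> 'a" where
  "left_act S g \<eta> = (\<lambda>X \<in> nil_alg S. \<eta> (matrix_inv g ** X))"

definition right_act :: "'n set \<Rightarrow> (('a::{field,finite}, 'n::{finite,linorder}) sqmat \<Rightarrow> 'a) \<Rightarrow>
    ('a, 'n) sqmat \<Rightarrow> ('a, 'n) sqmat \<Rightarrow> 'a" where
  "right_act S \<eta> g = (\<lambda>X \<in> nil_alg S. \<eta> (X ** matrix_inv g))"

definition right_orbit :: "'n set \<Rightarrow> (('a::{field,finite}, 'n::{finite,linorder}) sqmat \<Rightarrow> 'a) \<Rightarrow>
    (('a, 'n) sqmat \<Rightarrow> 'a) set" where
  "right_orbit S \<eta> = {right_act S \<eta> h | h. h \<in> UT S}"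

definition two_sided_orbit ::
  "'n set \<Rightarrow> (('a::{field,finite}, 'n::{finite,linorder}) sqmat \<Rightarrow> 'a) \<Rightarrow>
    (('a, 'n) sqmat \<Rightarrow> 'a) set" where
  "two_sided_orbit S \<eta> = {right_act S (left_act S g \<eta>) h | g h. g \<in> UT S \<and> h \<in> UT S}"

definition superchar :: "('a::{field,finite} \<Rightarrow> complex) \<Rightarrow> 'n set \<Rightarrow>
    (('a, 'n::{finite,linorder}) sqmat \<Rightarrow> 'a) \<Rightarrow> ('a, 'n) sqmat \<Rightarrow> complex" where
  "superchar \<theta> S \<eta> = (\<lambda>u \<in> UT S.
     of_nat (card (right_orbit S \<eta>)) / of_nat (card (two_sided_orbit S \<eta>)) *
     (\<Sum>\<mu> \<in> two_sided_orbit S \<eta>. \<theta> (\<mu> (u - mat 1))))"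

definition superclass :: "'n set \<Rightarrow> ('a::{field,finite}, 'n::{finite,linorder}) sqmat \<Rightarrow>
    ('a, 'n) sqmat set" where
  "superclass S X = {mat 1 + g ** X ** h | g h. g \<in> UT S \<and> h \<in> UT S}"

definition superclass_functions ::
  "'n set \<Rightarrow> (('a::{field,finite}, 'n::{finite,linorder}) sqmat \<Rightarrow> complex) set" where
  "superclass_functions S =
     {\<psi> \<in> extensional (UT S). \<forall>X \<in> nil_alg S. \<psi> constant_on superclass S X}"

definition arc_fun :: "'n \<Rightarrow> 'a \<Rightarrow> 'n \<Rightarrow>
    ('a::{field,finite}, 'n::{finite,linorder}) sqmat \<Rightarrow> 'a" where
  "arc_fun i a l = (\<lambda>X \<in> nil_alg UNIV. a * X $ i $ l)"

definition arc_char :: "('a::{field,finite} \<Rightarrow> complex) \<Rightarrow> 'n \<Rightarrow> 'a \<Rightarrow> 'n \<Rightarrow>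
    ('a, 'n::{finite,linorder}) sqmat \<Rightarrow> complex" where
  "arc_char \<theta> i a l = superchar \<theta> UNIV (arc_fun i a l)"

definition proj :: "'n set \<Rightarrow> ('a::{field,finite}, 'n::{finite,linorder}) sqmat \<Rightarrow>
    ('a, 'n) sqmat" where
  "proj S X = (\<chi> i j. if i \<in> S \<and> j \<in> S then X $ i $ j else 0)"

definition is_Sinf :: "('a::{field,finite} \<Rightarrow> complex) \<Rightarrow> 'n::{finite,linorder} set \<Rightarrow>
    ((('a, 'n) sqmat \<Rightarrow> complex) \<Rightarrow> (('a, 'n) sqmat \<Rightarrow> complex)) \<Rightarrow> bool" where
  "is_Sinf \<theta> S T \<longleftrightarrow>
     T \<in> superclass_functions S \<rightarrow>\<^sub>E superclass_functions UNIV \<and>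
     (\<forall>\<phi> \<in> superclass_functions S. \<forall>\<psi> \<in> superclass_functions S.
        T (\<lambda>u \<in> UT S. \<phi> u + \<psi> u) = (\<lambda>u \<in> UT UNIV. T \<phi> u + T \<psi> u)) \<and>
     (\<forall>c. \<forall>\<phi> \<in> superclass_functions S.
        T (\<lambda>u \<in> UT S. c * \<phi> u) = (\<lambda>u \<in> UT UNIV. c * T \<phi> u)) \<and>
     (\<forall>\<mu> \<in> dual S. T (superchar \<theta> S \<mu>) = superchar \<theta> UNIV (compose (nil_alg UNIV) \<mu> (proj S)))"

text \<open>
  The supercharacters form a basis of the superclass functions, and the superclass functions are
  extensional, so for nontrivial \<open>\<theta>\<close> exactly one map satisfies \<open>is_Sinf \<theta> S\<close>.
\<close>

definition Sinf :: "('a::{field,finite} \<Rightarrow> complex) \<Rightarrow> 'n::{finite,linorder} set \<Rightarrow>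
    (('a, 'n) sqmat \<Rightarrow> complex) \<Rightarrow> ('a, 'n) sqmat \<Rightarrow> complex" where
  "Sinf \<theta> S = (THE T. is_Sinf \<theta> S T)"

definition SinfRes :: "('a::{field,finite} \<Rightarrow> complex) \<Rightarrow> 'n::{finite,linorder} set \<Rightarrow>
    (('a, 'n) sqmat \<Rightarrow> complex) \<Rightarrow> ('a, 'n) sqmat \<Rightarrow> complex" where
  "SinfRes \<theta> S \<psi> = Sinf \<theta> S (restrict \<psi> (UT S))"

definition char_prod :: "(('a::{field,finite}, 'n::{finite,linorder}) sqmat \<Rightarrow> complex) \<Rightarrow>
    (('a, 'n) sqmat \<Rightarrow> complex) \<Rightarrow> ('a, 'n) sqmat \<Rightarrow> complex" (infixl "\<otimes>\<^sub>U" 70) where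
  "\<phi> \<otimes>\<^sub>U \<psi> = (\<lambda>u \<in> UT UNIV. \<phi> u * \<psi> u)"

end

theory Submission
  imports Defs
begin

text \<open>
  Put \<open>X = u - 1\<close>.  The two-sided orbit of the functional of the arc from \<open>i\<close> to \<open>l\<close> with label \<open>a\<close>
  consists of the bilinear forms \<open>X \<mapsto> a (s X t)\<close>, where the row vector \<open>s\<close> is supported on \<open>{i..<l}\<close>
  with \<open>s i = 1\<close> and the column vector \<open>t\<close> on \<open>{i<..l}\<close> with \<open>t l = 1\<close>, and where \<open>s\<close> and \<open>t\<close> are
  otherwise free.  Summing \<open>\<theta> (a (s X t))\<close> over \<open>s\<close> first, orthogonality of characters leaves only
  the \<open>t\<close> with \<open>(X t) p = 0\<close> for all \<open>p\<close> strictly between \<open>i\<close> and \<open>l\<close>, and the value of the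
  supercharacter is the sum of \<open>\<theta> (a (X t) i)\<close> over these \<open>t\<close> (\<open>arc_char_col_sols\<close>).  Summing over
  \<open>t\<close> first gives the mirror image, a sum over the \<open>s\<close> with \<open>(s X) q = 0\<close> for all \<open>q\<close> strictly
  between \<open>i\<close> and \<open>l\<close> (\<open>arc_char_row_sols\<close>).  So the supercharacter vanishes at \<open>u\<close> unless both
  linear systems are solvable, and in that case \<open>(X t) i = s X t = (s X) l\<close> does not depend on the
  solutions: the value is the number of solutions times \<open>\<theta> (a z)\<close> for a constant \<open>z\<close>
  (\<open>arc_char_consistent\<close>).

  The sets \<open>S\<close> in the theorem are intervals.  For these, deleting all entries outside \<open>S\<close> is
  multiplicative on upper-triangular matrices, so superinflation is the composition with a
  homomorphism of groups onto \<^term>\<open>UT S\<close> (\<open>inflation_is_Sinf\<close>).  It is the only linear map with the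
  prescribed values because the supercharacters span the superclass functions
  (\<open>superchar_spanning\<close>, by Fourier inversion).  Hence \<^term>\<open>SinfRes\<close> of an arc character at \<open>u\<close> is
  the value of that character at the matrix \<open>u\<close> with its entries outside \<open>S\<close> deleted.  If \<open>S\<close> omits
  \<open>i\<close> or \<open>l\<close>, then \<open>z\<close> becomes 0 and the value just counts the solutions of one of the two systems.

  The identities follow pointwise.  If the longer arc from \<open>i\<close> to \<open>l\<close> has a nonzero value, then row
  \<open>i\<close> of \<open>X\<close> is on \<open>{i<..<l}\<close> a combination of lower rows, and column \<open>l\<close> is a combination of earlier
  columns; so deleting that row or column does not change the value of a shorter arc starting at
  \<open>i\<close> or ending at \<open>l\<close>.  For equal arcs the factors \<open>\<theta> (a z)\<close> and \<open>\<theta> (b z)\<close> multiply to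
  \<open>\<theta> ((a + b) z)\<close>, and the remaining factors count solutions of the same linear systems.
\<close>

section \<open>The groups and their nilpotent algebras\<close>

lemma mem_nil_alg:
  fixes X :: "('a::{field,finite}, 'n::{finite,linorder}) sqmat"
  shows "X \<in> nil_alg S \<longleftrightarrow> (\<forall>p q. X $ p $ q \<noteq> 0 \<longrightarrow> p < q \<and> p \<in> S \<and> q \<in> S)"
proof
  assume "X \<in> nil_alg S"
  then obtain u where u: "u \<in> UT S" and X: "X = u - mat 1"
    unfolding nil_alg_def by blast
  have "p < q \<and> p \<in> S \<and> q \<in> S" if "X $ p $ q \<noteq> 0" for p q
    using u that unfolding X
    by (cases p q rule: linorder_cases) (auto simp: UT_def mat_def split: if_splits)
  then show "\<forall>p q. X $ p $ q \<noteq> 0 \<longrightarrow> p < q \<and> p \<in> S \<and> q \<in> S"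
    by blast
next
  assume X: "\<forall>p q. X $ p $ q \<noteq> 0 \<longrightarrow> p < q \<and> p \<in> S \<and> q \<in> S"
  have "X + mat 1 \<in> UT S"
    unfolding UT_def mat_def using X by (auto simp: order.asym) (use order.asym in blast)+
  then have "(X + mat 1) - mat 1 \<in> nil_alg S"
    unfolding nil_alg_def by (rule imageI)
  then show "X \<in> nil_alg S"
    by simp
qed

lemma UT_iff: "u \<in> UT S \<longleftrightarrow> u - mat 1 \<in> nil_alg S"
  unfolding nil_alg_def by (auto simp: image_iff)

lemma one_plus_UT_iff: "mat 1 + X \<in> UT S \<longleftrightarrow> X \<in> nil_alg S"
  by (simp add: UT_iff)

lemma UT_mono: "S \<subseteq> T \<Longrightarrow> UT S \<subseteq> UT T"
  unfolding UT_def by blast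

lemma nil_alg_mono: "S \<subseteq> T \<Longrightarrow> nil_alg S \<subseteq> nil_alg T"
  unfolding nil_alg_def by (intro image_mono UT_mono)

lemma one_in_UT: "mat 1 \<in> UT S"
  by (simp add: UT_iff mem_nil_alg)

lemma nil_alg_add: "X \<in> nil_alg S \<Longrightarrow> Y \<in> nil_alg S \<Longrightarrow> X + Y \<in> nil_alg S"
  unfolding mem_nil_alg by (metis add.right_neutral vector_add_component)

lemma nil_alg_diff: "X \<in> nil_alg S \<Longrightarrow> Y \<in> nil_alg S \<Longrightarrow> X - Y \<in> nil_alg S"
  unfolding mem_nil_alg by (metis diff_zero vector_minus_component diff_self)

lemma nil_alg_scale: "X \<in> nil_alg S \<Longrightarrow> map_matrix ((*) c) X \<in> nil_alg S"
  unfolding mem_nil_alg map_matrix_def by auto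

lemma UT_entry:
  fixes u :: "('a::{field,finite}, 'n::{finite,linorder}) sqmat"
  assumes "u \<in> UT S" "u $ p $ q \<noteq> 0"
  shows "p = q \<or> (p < q \<and> p \<in> S \<and> q \<in> S)"
proof (cases p q rule: linorder_cases)
qed (use assms in \<open>auto simp: UT_def\<close>)

lemma UT_diag: "u \<in> UT S \<Longrightarrow> u $ p $ p = 1"
  unfolding UT_def by blast

lemma matrix_mult_entry: "(A ** B) $ p $ q = (\<Sum>r\<in>UNIV. A $ p $ r * B $ r $ q)"
  by (simp add: matrix_matrix_mult_def)

lemma matrix_mult_entry_nonzeroE:
  assumes "(A ** B) $ p $ q \<noteq> 0"
  obtains r where "A $ p $ r \<noteq> 0" "B $ r $ q \<noteq> 0"
proof -
  have "\<exists>r. A $ p $ r * B $ r $ q \<noteq> 0"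
    using assms unfolding matrix_mult_entry by (meson sum.not_neutral_contains_not_neutral)
  then show thesis
    using that by (metis mult_zero_left mult_zero_right)
qed

lemma UT_mult_nil_alg:
  assumes "g \<in> UT S" "X \<in> nil_alg S"
  shows "g ** X \<in> nil_alg S"
  unfolding mem_nil_alg
proof (intro allI impI)
  fix p q assume "(g ** X) $ p $ q \<noteq> 0"
  then obtain r where "g $ p $ r \<noteq> 0" "X $ r $ q \<noteq> 0"
    by (rule matrix_mult_entry_nonzeroE)
  then show "p < q \<and> p \<in> S \<and> q \<in> S"
    using UT_entry[OF assms(1)] assms(2) unfolding mem_nil_alg by (metis order.strict_trans)
qed

lemma nil_alg_mult_UT:
  assumes "X \<in> nil_alg S" "h \<in> UT S"
  shows "X ** h \<in> nil_alg S"
  unfolding mem_nil_alg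
proof (intro allI impI)
  fix p q assume "(X ** h) $ p $ q \<noteq> 0"
  then obtain r where "X $ p $ r \<noteq> 0" "h $ r $ q \<noteq> 0"
    by (rule matrix_mult_entry_nonzeroE)
  then show "p < q \<and> p \<in> S \<and> q \<in> S"
    using UT_entry[OF assms(2)] assms(1) unfolding mem_nil_alg by (metis order.strict_trans)
qed

lemma nil_alg_two_sided:
  "g \<in> UT S \<Longrightarrow> X \<in> nil_alg S \<Longrightarrow> h \<in> UT S \<Longrightarrow> g ** X ** h \<in> nil_alg S"
  by (intro nil_alg_mult_UT UT_mult_nil_alg)

lemma UT_mult:
  fixes g h :: "('a::{field,finite}, 'n::{finite,linorder}) sqmat"
  assumes "g \<in> UT S" "h \<in> UT S"
  shows "g ** h \<in> UT S"
proof -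
  have "g ** h = g ** (h - mat 1) + g"
    by (metis add.commute diff_add_cancel matrix_add_ldistrib matrix_mul_rid)
  then have "g ** h - mat 1 = g ** (h - mat 1) + (g - mat 1)"
    by simp
  moreover have "g ** (h - mat 1) + (g - mat 1) \<in> nil_alg S"
    using assms by (intro nil_alg_add UT_mult_nil_alg) (simp_all flip: UT_iff)
  ultimately show ?thesis
    by (simp add: UT_iff add_diff_eq)
qed

text \<open>The last nonzero coordinate of a vector survives multiplication by a unipotent
  upper-triangular matrix, so such a matrix is invertible.  Left multiplication is then an injective
  self-map of the finite set \<^term>\<open>UT S\<close>, hence hits the identity: the inverse lies in
  \<^term>\<open>UT S\<close> again.\<close>

lemma UT_inverse:
  fixes u :: "('a::{field,finite}, 'n::{finite,linorder}) sqmat"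
  assumes u: "u \<in> UT S"
  shows "matrix_inv u \<in> UT S" "u ** matrix_inv u = mat 1" "matrix_inv u ** u = mat 1"
proof -
  have ker: "x = 0" if x: "u *v x = 0" for x
  proof (rule ccontr)
    assume "x \<noteq> 0"
    then have ne: "{p. x $ p \<noteq> 0} \<noteq> {}" by (auto simp: vec_eq_iff)
    define m where "m = Max {p. x $ p \<noteq> 0}"
    have m: "x $ m \<noteq> 0" using Max_in[OF _ ne] unfolding m_def by simp
    have above: "x $ q = 0" if "m < q" for q
      using that Max_ge[of "{p. x $ p \<noteq> 0}" q] unfolding m_def
      by (meson finite leD mem_Collect_eq)
    have "(\<Sum>q\<in>UNIV. u $ m $ q * x $ q) = (\<Sum>q\<in>UNIV. if q = m then x $ q else 0)"
    proof (rule sum.cong[OF refl])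
      fix q
      show "u $ m $ q * x $ q = (if q = m then x $ q else 0)"
        using UT_diag[OF u, of m] UT_entry[OF u, of m q] above by auto
    qed
    then have "(u *v x) $ m = x $ m"
      by (simp add: matrix_vector_mult_def)
    with x m show False by simp
  qed
  have "inj ((*v) u)"
    unfolding vec.inj_iff_eq_0 using ker by blast
  then obtain B where B: "B ** u = mat 1" "u ** B = mat 1"
    by (metis matrix_left_invertible_injective matrix_left_right_inverse)
  then have "invertible u"
    unfolding invertible_def by blast
  then have inv: "u ** matrix_inv u = mat 1 \<and> matrix_inv u ** u = mat 1"
    unfolding invertible_def matrix_inv_def by (rule someI_ex)
  then show "u ** matrix_inv u = mat 1" "matrix_inv u ** u = mat 1" by auto
  have "inj_on ((**) u) (UT S)"
    by (rule inj_onI) (metis inv matrix_mul_assoc matrix_mul_lid)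
  moreover have "(**) u ` UT S \<subseteq> UT S"
    using UT_mult[OF u] by blast
  ultimately have "(**) u ` UT S = UT S"
    by (simp add: endo_inj_surj)
  then obtain x where "x \<in> UT S" "u ** x = mat 1"
    using one_in_UT by (metis imageE)
  moreover have "x = matrix_inv u"
    by (metis \<open>u ** x = mat 1\<close> inv matrix_mul_assoc matrix_mul_lid matrix_mul_rid)
  ultimately show "matrix_inv u \<in> UT S" by simp
qed

lemma matrix_inv_matrix_inv_UT:
  assumes "u \<in> UT S"
  shows "matrix_inv (matrix_inv u) = u"
  using UT_inverse[OF assms] UT_inverse[OF UT_inverse(1)[OF assms]]
  by (metis matrix_mul_assoc matrix_mul_lid matrix_mul_rid)

section \<open>Orbits of functionals\<close>

text \<open>Since inversion permutes the group, the orbits of a functional \<open>\<eta>\<close> consist of all the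
  functionals \<open>X \<mapsto> \<eta> (g X h)\<close>; this description avoids inverse matrices.\<close>

definition twist :: "'n set \<Rightarrow> ('a::{field,finite}, 'n::{finite,linorder}) sqmat \<Rightarrow>
    ('a, 'n) sqmat \<Rightarrow> (('a, 'n) sqmat \<Rightarrow> 'a) \<Rightarrow> ('a, 'n) sqmat \<Rightarrow> 'a" where
  "twist S g h \<eta> = (\<lambda>X \<in> nil_alg S. \<eta> (g ** X ** h))"

lemma twist_apply: "X \<in> nil_alg S \<Longrightarrow> twist S g h \<eta> X = \<eta> (g ** X ** h)"
  by (simp add: twist_def)

lemma right_act_left_act:
  assumes "g \<in> UT S" "h \<in> UT S"
  shows "right_act S (left_act S g \<eta>) h = twist S (matrix_inv g) (matrix_inv h) \<eta>"
  unfolding right_act_def left_act_def twist_def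
  by (rule restrict_ext)
    (simp add: nil_alg_mult_UT UT_inverse(1)[OF assms(2)] matrix_mul_assoc)

lemma two_sided_orbit_eq:
  "two_sided_orbit S \<eta> = {twist S g h \<eta> | g h. g \<in> UT S \<and> h \<in> UT S}"
proof -
  have "twist S g h \<eta> = right_act S (left_act S (matrix_inv g) \<eta>) (matrix_inv h)"
    if "g \<in> UT S" "h \<in> UT S" for g h
    using that by (simp add: right_act_left_act UT_inverse(1) matrix_inv_matrix_inv_UT)
  then show ?thesis
    unfolding two_sided_orbit_def
    by (auto simp: right_act_left_act) (metis UT_inverse(1))+
qed

lemma right_orbit_eq: "right_orbit S \<eta> = {twist S (mat 1) h \<eta> | h. h \<in> UT S}"
proof -
  have act: "right_act S \<eta> h = twist S (mat 1) (matrix_inv h) \<eta>" for h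
    unfolding right_act_def twist_def by simp
  have "twist S (mat 1) h \<eta> = right_act S \<eta> (matrix_inv h)" if "h \<in> UT S" for h
    using that by (simp add: act matrix_inv_matrix_inv_UT)
  then show ?thesis
    unfolding right_orbit_def by (auto simp: act) (metis UT_inverse(1))+
qed

lemma twist_twist:
  assumes "g \<in> UT S" "h \<in> UT S"
  shows "twist S g h (twist S g' h' \<eta>) = twist S (g' ** g) (h ** h') \<eta>"
  unfolding twist_def
  by (rule restrict_ext) (simp add: nil_alg_two_sided assms matrix_mul_assoc)

lemma twist_one: "\<eta> \<in> extensional (nil_alg S) \<Longrightarrow> twist S (mat 1) (mat 1) \<eta> = \<eta>"
  unfolding twist_def by (rule ext) (simp add: extensional_def)

lemma dual_add:
  "\<eta> \<in> dual S \<Longrightarrow> X \<in> nil_alg S \<Longrightarrow> Y \<in> nil_alg S \<Longrightarrow> \<eta> (X + Y) = \<eta> X + \<eta> Y"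
  unfolding dual_def by blast

lemma dual_diff:
  assumes "\<eta> \<in> dual S" "X \<in> nil_alg S" "Y \<in> nil_alg S"
  shows "\<eta> (X - Y) = \<eta> X - \<eta> Y"
  using dual_add[OF assms(1) nil_alg_diff[OF assms(2,3)] assms(3)] by simp

lemma dual_extensional: "\<eta> \<in> dual S \<Longrightarrow> \<eta> \<in> extensional (nil_alg S)"
  unfolding dual_def by blast

lemma matrix_mult_scale:
  fixes A B X :: "'a::field ^'n^'n"
  shows "A ** map_matrix ((*) c) X ** B = map_matrix ((*) c) (A ** X ** B)"
  by (simp add: vec_eq_iff matrix_mult_entry map_matrix_def sum_distrib_left
      sum_distrib_right ac_simps)

lemma matrix_mult_add_sandwich:
  fixes A B X Y :: "'a::field ^'n^'n"
  shows "A ** (X + Y) ** B = A ** X ** B + A ** Y ** B"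
  by (simp add: vec_eq_iff matrix_mult_entry sum.distrib algebra_simps)

lemma twist_dual:
  assumes "\<eta> \<in> dual S" "g \<in> UT S" "h \<in> UT S"
  shows "twist S g h \<eta> \<in> dual S"
  using assms unfolding dual_def twist_def
  by (auto simp: nil_alg_add nil_alg_scale nil_alg_two_sided matrix_mult_add_sandwich
      matrix_mult_scale)

lemma orbit_subset_dual: "\<eta> \<in> dual S \<Longrightarrow> two_sided_orbit S \<eta> \<subseteq> dual S"
  unfolding two_sided_orbit_eq using twist_dual by blast

lemma self_in_orbit: "\<eta> \<in> dual S \<Longrightarrow> \<eta> \<in> two_sided_orbit S \<eta>"
  unfolding two_sided_orbit_eq
  by (rule CollectI, intro exI[of _ "mat 1"] conjI)
    (simp_all add: one_in_UT twist_one dual_extensional)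

lemma orbit_twist_closed:
  assumes "\<mu> \<in> two_sided_orbit S \<eta>" "g \<in> UT S" "h \<in> UT S"
  shows "twist S g h \<mu> \<in> two_sided_orbit S \<eta>"
  using assms unfolding two_sided_orbit_eq by (auto simp: twist_twist) (metis UT_mult)

lemma twist_undo:
  assumes "\<eta> \<in> extensional (nil_alg S)" "g \<in> UT S" "h \<in> UT S"
  shows "twist S (matrix_inv g) (matrix_inv h) (twist S g h \<eta>) = \<eta>"
    "twist S g h (twist S (matrix_inv g) (matrix_inv h) \<eta>) = \<eta>"
  using assms by (simp_all add: twist_twist UT_inverse twist_one)

lemma orbit_sym:
  assumes "\<eta> \<in> dual S" "\<mu> \<in> two_sided_orbit S \<eta>"
  shows "\<eta> \<in> two_sided_orbit S \<mu>"
proof -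
  obtain g h where gh: "g \<in> UT S" "h \<in> UT S" "\<mu> = twist S g h \<eta>"
    using assms(2) unfolding two_sided_orbit_eq by blast
  then have "\<eta> = twist S (matrix_inv g) (matrix_inv h) \<mu>"
    using twist_undo[OF dual_extensional[OF assms(1)]] by simp
  then show ?thesis
    unfolding two_sided_orbit_eq using gh UT_inverse(1) by blast
qed

lemma orbit_eq:
  fixes \<eta> :: "('a::{field,finite}, 'b::{finite,linorder}) sqmat \<Rightarrow> 'a"
  assumes "\<eta> \<in> dual S" "\<mu> \<in> two_sided_orbit S \<eta>"
  shows "two_sided_orbit S \<mu> = two_sided_orbit S \<eta>"
proof -
  have "two_sided_orbit S \<nu> \<subseteq> two_sided_orbit S \<kappa>" if "\<nu> \<in> two_sided_orbit S \<kappa>" for \<nu> \<kappa> :: "('a, 'b) sqmat \<Rightarrow> 'a"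
    using orbit_twist_closed[OF that] unfolding two_sided_orbit_eq[of S \<nu>] by blast
  then show ?thesis
    using assms orbit_sym by blast
qed

section \<open>Supercharacters span the superclass functions\<close>

lemma superclass_functions_iff:
  "\<psi> \<in> superclass_functions S \<longleftrightarrow> \<psi> \<in> extensional (UT S) \<and>
    (\<forall>X \<in> nil_alg S. \<forall>g \<in> UT S. \<forall>h \<in> UT S. \<psi> (mat 1 + g ** X ** h) = \<psi> (mat 1 + X))"
    (is "?L \<longleftrightarrow> ?R")
proof
  assume L: ?L
  have "\<psi> (mat 1 + g ** X ** h) = \<psi> (mat 1 + X)"
    if X: "X \<in> nil_alg S" and gh: "g \<in> UT S" "h \<in> UT S" for X g h
  proof -
    obtain y where y: "\<And>v. v \<in> superclass S X \<Longrightarrow> \<psi> v = y"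
      using L X unfolding superclass_functions_def constant_on_def by blast
    have "mat 1 + g ** X ** h \<in> superclass S X"
      unfolding superclass_def using gh by blast
    moreover have "mat 1 + mat 1 ** X ** mat 1 \<in> superclass S X"
      unfolding superclass_def using one_in_UT by blast
    ultimately show ?thesis using y by simp
  qed
  then show ?R
    using L unfolding superclass_functions_def by blast
next
  assume R: ?R
  have "\<psi> constant_on superclass S X" if "X \<in> nil_alg S" for X
    unfolding constant_on_def superclass_def
    using R that by (intro exI[of _ "\<psi> (mat 1 + X)"]) blast
  with R show ?L
    unfolding superclass_functions_def by blast
qed

lemma superclass_functions_add:
  assumes "\<phi> \<in> superclass_functions S" "\<psi> \<in> superclass_functions S"
  shows "(\<lambda>u\<in>UT S. \<phi> u + \<psi> u) \<in> superclass_functions S"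
  using assms unfolding superclass_functions_iff
  by (simp add: one_plus_UT_iff nil_alg_two_sided)

lemma superclass_functions_scale:
  assumes "\<phi> \<in> superclass_functions S"
  shows "(\<lambda>u\<in>UT S. c * \<phi> u) \<in> superclass_functions S"
  using assms unfolding superclass_functions_iff
  by (simp add: one_plus_UT_iff nil_alg_two_sided)

lemma superclass_functions_restrict:
  assumes "\<phi> \<in> superclass_functions T" "S \<subseteq> T"
  shows "restrict \<phi> (UT S) \<in> superclass_functions S"
  using assms UT_mono[OF assms(2)] nil_alg_mono[OF assms(2)] unfolding superclass_functions_iff
  by (auto simp: one_plus_UT_iff nil_alg_two_sided subset_iff)

lemma superclass_functions_zero: "(\<lambda>u\<in>UT S. 0) \<in> superclass_functions S"
  unfolding superclass_functions_iff by (simp add: one_plus_UT_iff nil_alg_two_sided)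

locale additive_character =
  fixes \<theta> :: "'a::{field,finite} \<Rightarrow> complex"
  assumes hom: "\<theta> (x + y) = \<theta> x * \<theta> y"
    and nonzero: "\<theta> x \<noteq> 0"
    and nontrivial: "\<exists>x. \<theta> x \<noteq> 1"
begin

lemma theta_zero: "\<theta> 0 = 1"
  using hom[of 0 0] nonzero[of 0] by simp

lemma theta_diff: "\<theta> (x - y) = \<theta> x * \<theta> (- y)"
  using hom[of x "- y"] by simp

text \<open>The form in which orthogonality of characters is used throughout: a substitution that
  multiplies each summand by a constant other than 1 kills the sum.\<close>

lemma sum_theta_shift_zero:
  assumes "bij_betw \<tau> W W" "\<And>w. w \<in> W \<Longrightarrow> F (\<tau> w) = F w + c" "\<theta> c \<noteq> 1"
  shows "(\<Sum>w\<in>W. \<theta> (F w)) = 0"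
proof -
  have "(\<Sum>w\<in>W. \<theta> (F w)) = (\<Sum>w\<in>W. \<theta> (F (\<tau> w)))"
    by (rule sum.reindex_bij_betw[OF assms(1), of "\<lambda>w. \<theta> (F w)", symmetric])
  also have "\<dots> = (\<Sum>w\<in>W. \<theta> (F w)) * \<theta> c"
    by (simp add: assms(2) hom sum_distrib_right)
  finally show ?thesis
    using assms(3) by simp
qed

lemma dual_orthogonality:
  fixes X :: "('a, 'n::{finite,linorder}) sqmat"
  assumes X: "X \<in> nil_alg S" "X \<noteq> 0"
  shows "(\<Sum>\<eta>\<in>dual S. \<theta> (\<eta> X)) = 0"
proof -
  obtain p q where pq: "X $ p $ q \<noteq> 0"
    using X(2) by (auto simp: vec_eq_iff)
  obtain x where x: "\<theta> x \<noteq> 1" using nontrivial by blast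
  \<comment> \<open>Adding \<open>c\<close> times the coordinate at \<open>(p, q)\<close> raises the value at \<open>X\<close> by \<open>x\<close>.\<close>
  define c where "c = x / X $ p $ q"
  let ?\<tau> = "\<lambda>c (\<eta> :: ('a, 'n) sqmat \<Rightarrow> 'a). \<lambda>Y\<in>nil_alg S. \<eta> Y + c * Y $ p $ q"
  have closed: "?\<tau> d \<eta> \<in> dual S" if "\<eta> \<in> dual S" for d \<eta>
    using that unfolding dual_def
    by (auto simp: nil_alg_add nil_alg_scale nth_map_matrix algebra_simps)
  have inverse: "?\<tau> e (?\<tau> d \<eta>) = \<eta>" if "\<eta> \<in> dual S" "e = - d" for d e \<eta>
    by (rule extensionalityI[OF _ dual_extensional[OF that(1)]]) (simp_all add: that(2))
  have "bij_betw (?\<tau> c) (dual S) (dual S)"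
  proof (rule bij_betw_byWitness[where f' = "?\<tau> (- c)"])
    show "\<forall>\<eta>\<in>dual S. ?\<tau> (- c) (?\<tau> c \<eta>) = \<eta>"
      using inverse by blast
    show "\<forall>\<eta>\<in>dual S. ?\<tau> c (?\<tau> (- c) \<eta>) = \<eta>"
      by (intro ballI inverse) simp_all
  qed (use closed in blast)+
  moreover have "?\<tau> c \<eta> X = \<eta> X + x" for \<eta>
    using X(1) pq by (simp add: c_def)
  ultimately show ?thesis
    using x sum_theta_shift_zero[where F = "\<lambda>\<eta>. \<eta> X"] by blast
qed

lemma orbit_sum_invariant:
  assumes "\<eta> \<in> dual S" "X \<in> nil_alg S" "g \<in> UT S" "h \<in> UT S"
  shows "(\<Sum>\<mu>\<in>two_sided_orbit S \<eta>. \<theta> (\<mu> (g ** X ** h))) =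
    (\<Sum>\<mu>\<in>two_sided_orbit S \<eta>. \<theta> (\<mu> X))"
proof -
  let ?O = "two_sided_orbit S \<eta>"
  have ext: "\<mu> \<in> extensional (nil_alg S)" if "\<mu> \<in> ?O" for \<mu>
    using that orbit_subset_dual[OF assms(1)] dual_extensional by blast
  have "bij_betw (twist S g h) ?O ?O"
    by (rule bij_betw_byWitness[where f' = "twist S (matrix_inv g) (matrix_inv h)"])
      (auto simp: twist_undo ext assms orbit_twist_closed UT_inverse)
  from sum.reindex_bij_betw[OF this, of "\<lambda>\<mu>. \<theta> (\<mu> X)"] show ?thesis
    by (simp add: twist_apply assms(2))
qed

lemma superchar_one_plus:
  assumes "X \<in> nil_alg S"
  shows "superchar \<theta> S \<eta> (mat 1 + X) =
    of_nat (card (right_orbit S \<eta>)) / of_nat (card (two_sided_orbit S \<eta>)) *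
    (\<Sum>\<mu>\<in>two_sided_orbit S \<eta>. \<theta> (\<mu> X))"
  using assms by (simp add: superchar_def one_plus_UT_iff)

lemma superchar_superclass_function:
  assumes "\<eta> \<in> dual S"
  shows "superchar \<theta> S \<eta> \<in> superclass_functions S"
  unfolding superclass_functions_iff
proof
  show "superchar \<theta> S \<eta> \<in> extensional (UT S)"
    by (simp add: superchar_def)
qed (auto simp: superchar_one_plus nil_alg_two_sided orbit_sum_invariant assms)

text \<open>Fourier inversion on \<^term>\<open>nil_alg S\<close> writes a superclass function as a combination of the
  functions \<open>X \<mapsto> \<theta> (\<lambda> X)\<close>.  Invariance of the function makes the Fourier coefficients constant on
  the two-sided orbits, so the terms of each orbit add up to a multiple of a supercharacter.\<close>

lemma superchar_spanning:
  fixes \<phi> :: "('a, 'n::{finite,linorder}) sqmat \<Rightarrow> complex"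
  assumes \<phi>: "\<phi> \<in> superclass_functions S"
  shows "\<exists>d. \<phi> = (\<lambda>u\<in>UT S. \<Sum>\<eta>\<in>dual S. d \<eta> * superchar \<theta> S \<eta> u)"
proof -
  define D where "D = (dual S :: (('a, 'n) sqmat \<Rightarrow> 'a) set)"
  define f where "f X = \<phi> (mat 1 + X)" for X
  define c where "c \<eta> = (\<Sum>Y\<in>nil_alg S. f Y * \<theta> (- \<eta> Y)) / of_nat (card D)" for \<eta>
  let ?O = "\<lambda>\<eta> :: ('a, 'n) sqmat \<Rightarrow> 'a. two_sided_orbit S \<eta>"
  let ?R = "\<lambda>\<eta> :: ('a, 'n) sqmat \<Rightarrow> 'a. right_orbit S \<eta>"
  have "(\<lambda>X\<in>nil_alg S. 0) \<in> D"
    unfolding D_def dual_def by (simp add: nil_alg_add nil_alg_scale)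
  then have D0: "card D \<noteq> 0" by auto
  have OD: "?O \<eta> \<subseteq> D" if "\<eta> \<in> D" for \<eta>
    using that orbit_subset_dual unfolding D_def by blast
  have O0: "?O \<eta> \<noteq> {}" and R0: "?R \<eta> \<noteq> {}" if "\<eta> \<in> D" for \<eta>
    using self_in_orbit[of \<eta> S] that one_in_UT[of S] unfolding D_def right_orbit_eq by auto
  have f_invariant: "f (g ** Y ** h) = f Y"
    if "Y \<in> nil_alg S" "g \<in> UT S" "h \<in> UT S" for Y g h
    using \<phi> that unfolding superclass_functions_iff f_def by blast
  have c_orbit: "c \<mu> = c \<eta>" if \<eta>: "\<eta> \<in> D" and \<mu>: "\<mu> \<in> ?O \<eta>" for \<mu> \<eta>
  proof -
    obtain g h where gh: "g \<in> UT S" "h \<in> UT S" "\<mu> = twist S g h \<eta>"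
      using \<mu> unfolding two_sided_orbit_eq by blast
    have cancel: "A ** (B ** Y ** C) ** E = Y"
      if "A ** B = mat 1" "C ** E = mat 1" for A B C E Y :: "('a, 'n) sqmat"
      by (metis that matrix_mul_assoc matrix_mul_lid matrix_mul_rid)
    have "bij_betw (\<lambda>Y. g ** Y ** h) (nil_alg S) (nil_alg S)"
      by (rule bij_betw_byWitness[where f' = "\<lambda>Y. matrix_inv g ** Y ** matrix_inv h"])
        (use gh(1,2) in \<open>auto simp: nil_alg_two_sided UT_inverse cancel\<close>)
    from sum.reindex_bij_betw[OF this, of "\<lambda>Y. f Y * \<theta> (- \<eta> Y)"]
    have "(\<Sum>Y\<in>nil_alg S. f Y * \<theta> (- \<mu> Y)) = (\<Sum>Y\<in>nil_alg S. f Y * \<theta> (- \<eta> Y))"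
      by (simp add: gh f_invariant twist_apply)
    then show ?thesis unfolding c_def by simp
  qed
  have inversion: "f X = (\<Sum>\<eta>\<in>D. c \<eta> * \<theta> (\<eta> X))" if X: "X \<in> nil_alg S" for X
  proof -
    have "(\<Sum>\<eta>\<in>D. c \<eta> * \<theta> (\<eta> X)) =
        (\<Sum>\<eta>\<in>D. \<Sum>Y\<in>nil_alg S. f Y / of_nat (card D) * \<theta> (\<eta> (X - Y)))"
      using X by (intro sum.cong refl)
        (simp add: c_def D_def dual_diff theta_diff sum_distrib_left sum_divide_distrib ac_simps)
    also have "\<dots> = (\<Sum>Y\<in>nil_alg S. \<Sum>\<eta>\<in>D. f Y / of_nat (card D) * \<theta> (\<eta> (X - Y)))"
      by (rule sum.swap)
    also have "\<dots> = (\<Sum>Y\<in>nil_alg S. if Y = X then f X else 0)"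
    proof (rule sum.cong[OF refl])
      fix Y :: "('a, 'n) sqmat" assume Y: "Y \<in> nil_alg S"
      show "(\<Sum>\<eta>\<in>D. f Y / of_nat (card D) * \<theta> (\<eta> (X - Y))) = (if Y = X then f X else 0)"
      proof (cases "Y = X")
        case True
        have "\<theta> (\<eta> 0) = 1" if "\<eta> \<in> D" for \<eta>
          using dual_diff[of \<eta> S X X] that X by (simp add: D_def theta_zero)
        then have "(\<Sum>\<eta>\<in>D. f Y / of_nat (card D) * \<theta> (\<eta> (X - Y))) = (\<Sum>\<eta>\<in>D. f X / of_nat (card D))"
          using True by (intro sum.cong refl) simp
        then show ?thesis using True D0 by simp
      next
        case False
        then have "(\<Sum>\<eta>\<in>D. \<theta> (\<eta> (X - Y))) = 0"
          unfolding D_def by (intro dual_orthogonality nil_alg_diff X Y) simp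
        with False show ?thesis
          unfolding sum_distrib_left[symmetric] by simp
      qed
    qed
    also have "\<dots> = f X" using X by simp
    finally show ?thesis by simp
  qed
  define d where "d \<eta> = c \<eta> / of_nat (card (?R \<eta>))" for \<eta>
  have "\<phi> u = (\<Sum>\<eta>\<in>D. d \<eta> * superchar \<theta> S \<eta> u)" if u: "u \<in> UT S" for u
  proof -
    define X where "X = u - mat 1"
    have X: "X \<in> nil_alg S" and uX: "u = mat 1 + X"
      using u by (simp_all add: X_def UT_iff)
    \<comment> \<open>Both sums range over the pairs of functionals in a common orbit.\<close>
    have "(\<Sum>\<eta>\<in>D. d \<eta> * superchar \<theta> S \<eta> u) =
        (\<Sum>\<eta>\<in>D. \<Sum>\<mu>\<in>?O \<eta>. c \<eta> / of_nat (card (?O \<eta>)) * \<theta> (\<mu> X))"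
      unfolding uX
      by (intro sum.cong refl) (simp add: d_def superchar_one_plus X R0 sum_distrib_left)
    also have "\<dots> = (\<Sum>\<eta>\<in>D. \<Sum>\<mu>\<in>{\<mu> \<in> D. \<mu> \<in> ?O \<eta>}. c \<eta> / of_nat (card (?O \<eta>)) * \<theta> (\<mu> X))"
      by (intro sum.cong refl) (use OD in blast)
    also have "\<dots> = (\<Sum>\<mu>\<in>D. \<Sum>\<eta>\<in>{\<eta> \<in> D. \<mu> \<in> ?O \<eta>}. c \<eta> / of_nat (card (?O \<eta>)) * \<theta> (\<mu> X))"
      by (rule sum.swap_restrict) simp_all
    also have "\<dots> = (\<Sum>\<mu>\<in>D. \<Sum>\<eta>\<in>?O \<mu>. c \<mu> / of_nat (card (?O \<mu>)) * \<theta> (\<mu> X))"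
    proof (rule sum.cong[OF refl])
      fix \<mu> assume \<mu>: "\<mu> \<in> D"
      have "{\<eta> \<in> D. \<mu> \<in> ?O \<eta>} = ?O \<mu>"
        using orbit_sym[of _ S] \<mu> OD[OF \<mu>] unfolding D_def by blast
      moreover have "c \<eta> = c \<mu>" "?O \<eta> = ?O \<mu>" if "\<eta> \<in> ?O \<mu>" for \<eta>
        using c_orbit[OF \<mu> that] orbit_eq[of \<mu> S \<eta>] \<mu> that unfolding D_def by auto
      ultimately show "(\<Sum>\<eta>\<in>{\<eta> \<in> D. \<mu> \<in> ?O \<eta>}. c \<eta> / of_nat (card (?O \<eta>)) * \<theta> (\<mu> X)) =
          (\<Sum>\<eta>\<in>?O \<mu>. c \<mu> / of_nat (card (?O \<mu>)) * \<theta> (\<mu> X))"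
        by (intro sum.cong) auto
    qed
    also have "\<dots> = (\<Sum>\<mu>\<in>D. c \<mu> * \<theta> (\<mu> X))"
      by (intro sum.cong refl) (use O0 in simp)
    also have "\<dots> = \<phi> u"
      using inversion[OF X] by (simp add: f_def uX)
    finally show ?thesis by simp
  qed
  then have "\<phi> = (\<lambda>u\<in>UT S. \<Sum>\<eta>\<in>dual S. d \<eta> * superchar \<theta> S \<eta> u)"
    using \<phi> unfolding superclass_functions_iff D_def
    by (intro extensionalityI[of _ "UT S"]) auto
  then show ?thesis by blast
qed

section \<open>Superinflation from an interval is inflation of groups\<close>

text \<open>Additivity of \<open>T\<close> is available for two superclass functions at a time, so the induction carries
  along that the partial sums are superclass functions.\<close>

lemma is_Sinf_combination:
  assumes T: "is_Sinf \<theta> S T" and "finite A" "A \<subseteq> dual S"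
  shows "(\<lambda>u\<in>UT S. \<Sum>\<eta>\<in>A. d \<eta> * superchar \<theta> S \<eta> u) \<in> superclass_functions S \<and>
    T (\<lambda>u\<in>UT S. \<Sum>\<eta>\<in>A. d \<eta> * superchar \<theta> S \<eta> u) =
      (\<lambda>u\<in>UT UNIV. \<Sum>\<eta>\<in>A. d \<eta> * superchar \<theta> UNIV (compose (nil_alg UNIV) \<eta> (proj S)) u)"
  using assms(2,3)
proof (induction A rule: finite_induct)
  case empty
  \<comment> \<open>The zero function goes to zero because it is 0 times itself.\<close>
  have "T (\<lambda>u\<in>UT S. 0 * (\<lambda>u\<in>UT S. 0) u) = (\<lambda>u\<in>UT UNIV. 0 * T (\<lambda>u\<in>UT S. 0) u)"
    using T superclass_functions_zero unfolding is_Sinf_def by blast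
  then show ?case
    using superclass_functions_zero by (simp only: sum.empty mult_zero_left simp_thms)
next
  case (insert \<eta> A)
  let ?t = "\<lambda>u\<in>UT S. d \<eta> * superchar \<theta> S \<eta> u"
  let ?s = "\<lambda>u\<in>UT S. \<Sum>\<mu>\<in>A. d \<mu> * superchar \<theta> S \<mu> u"
  let ?P = "\<lambda>\<eta>. superchar \<theta> UNIV (compose (nil_alg UNIV) \<eta> (proj S))"
  from insert have \<eta>: "\<eta> \<in> dual S" by simp
  have s: "?s \<in> superclass_functions S"
    "T ?s = (\<lambda>u\<in>UT UNIV. \<Sum>\<mu>\<in>A. d \<mu> * ?P \<mu> u)"
    using insert by blast+
  have t: "?t \<in> superclass_functions S"
    by (intro superclass_functions_scale superchar_superclass_function \<eta>)
  have "T ?t = (\<lambda>u\<in>UT UNIV. d \<eta> * T (superchar \<theta> S \<eta>) u)"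
    using T superchar_superclass_function[OF \<eta>] unfolding is_Sinf_def by blast
  also have "T (superchar \<theta> S \<eta>) = ?P \<eta>"
    using T \<eta> unfolding is_Sinf_def by blast
  finally have Tt: "T ?t = (\<lambda>u\<in>UT UNIV. d \<eta> * ?P \<eta> u)" .
  have st: "(\<lambda>u\<in>UT S. \<Sum>\<eta>\<in>insert \<eta> A. d \<eta> * superchar \<theta> S \<eta> u) = (\<lambda>u\<in>UT S. ?t u + ?s u)"
    using insert.hyps by (intro restrict_ext) simp
  have "T (\<lambda>u\<in>UT S. ?t u + ?s u) = (\<lambda>u\<in>UT UNIV. T ?t u + T ?s u)"
    using T s(1) t unfolding is_Sinf_def by blast
  also have "\<dots> = (\<lambda>u\<in>UT UNIV. \<Sum>\<eta>\<in>insert \<eta> A. d \<eta> * ?P \<eta> u)"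
    unfolding Tt s(2) using insert.hyps by (intro restrict_ext) simp
  finally show ?case
    using superclass_functions_add[OF t s(1)] unfolding st by blast
qed

lemma is_Sinf_unique:
  assumes "is_Sinf \<theta> S T" "is_Sinf \<theta> S T'"
  shows "T = T'"
proof (rule extensionalityI[of _ "superclass_functions S"])
  show "T \<in> extensional (superclass_functions S)" "T' \<in> extensional (superclass_functions S)"
    using assms unfolding is_Sinf_def by (auto simp: PiE_def)
  fix \<phi> :: "('a, 'b) sqmat \<Rightarrow> complex"
  assume "\<phi> \<in> superclass_functions S"
  then obtain d where "\<phi> = (\<lambda>u\<in>UT S. \<Sum>\<eta>\<in>dual S. d \<eta> * superchar \<theta> S \<eta> u)"
    using superchar_spanning by blast
  then show "T \<phi> = T' \<phi>"
    using is_Sinf_combination[OF assms(1), of "dual S" d]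
      is_Sinf_combination[OF assms(2), of "dual S" d] by simp
qed

end

text \<open>For an interval \<open>S\<close> this is a retraction of groups from \<^term>\<open>UT UNIV\<close> onto \<^term>\<open>UT S\<close>.\<close>

definition uproj :: "'n set \<Rightarrow> ('a::{field,finite}, 'n::{finite,linorder}) sqmat \<Rightarrow>
    ('a, 'n) sqmat" where
  "uproj S u = mat 1 + proj S (u - mat 1)"

definition order_convex :: "'n::linorder set \<Rightarrow> bool" where
  "order_convex S \<longleftrightarrow> (\<forall>p\<in>S. \<forall>r\<in>S. \<forall>q. p \<le> q \<longrightarrow> q \<le> r \<longrightarrow> q \<in> S)"

lemma order_convex_intervals:
  "order_convex {p<..q}" "order_convex {p..<q}" "order_convex {p<..<q}"
  unfolding order_convex_def by auto

lemma proj_entry: "proj S X $ p $ q = (if p \<in> S \<and> q \<in> S then X $ p $ q else 0)"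
  by (simp add: proj_def)

lemma proj_nil_alg: "X \<in> nil_alg UNIV \<Longrightarrow> proj S X \<in> nil_alg S"
  by (simp add: mem_nil_alg proj_entry)

lemma proj_id: "X \<in> nil_alg S \<Longrightarrow> proj S X = X"
  by (auto simp: mem_nil_alg proj_entry vec_eq_iff)

lemma uproj_UT: "u \<in> UT UNIV \<Longrightarrow> uproj S u \<in> UT S"
  by (simp add: uproj_def one_plus_UT_iff proj_nil_alg UT_iff)

lemma uproj_id: "u \<in> UT S \<Longrightarrow> uproj S u = u"
  by (simp add: uproj_def proj_id UT_iff)

lemma uproj_one_plus: "uproj S (mat 1 + X) = mat 1 + proj S X"
  by (simp add: uproj_def)

lemma uproj_image: "uproj S ` UT UNIV = UT S"
proof
  show "UT S \<subseteq> uproj S ` UT UNIV"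
  proof
    fix u assume u: "u \<in> UT S"
    then have "u \<in> UT UNIV" using UT_mono by blast
    then show "u \<in> uproj S ` UT UNIV"
      by (rule image_eqI[rotated]) (simp add: uproj_id u)
  qed
qed (auto simp: uproj_UT)

lemma uproj_entry:
  assumes "u \<in> UT UNIV"
  shows "uproj S u $ p $ q = (if p = q then 1 else if p \<in> S \<and> q \<in> S then u $ p $ q else 0)"
  using UT_diag[OF assms] by (simp add: uproj_def proj_entry mat_def)

text \<open>In an entry of a product of upper-triangular matrices the summation index runs between row and
  column.  For a convex \<open>S\<close> it therefore stays in \<open>S\<close>, which makes projection multiplicative.\<close>

lemma proj_UT_mult:
  assumes S: "order_convex S" and g: "g \<in> UT UNIV" and X: "X \<in> nil_alg UNIV"
  shows "proj S (g ** X) = uproj S g ** proj S X"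
proof -
  have "proj S (g ** X) $ p $ q = (uproj S g ** proj S X) $ p $ q" for p q
  proof (cases "p \<in> S \<and> q \<in> S")
    case True
    have "g $ p $ r * X $ r $ q = uproj S g $ p $ r * proj S X $ r $ q" for r
    proof (cases "r \<in> S")
      case True
      then show ?thesis
        using \<open>p \<in> S \<and> q \<in> S\<close> UT_diag[OF g] by (simp add: uproj_entry[OF g] proj_entry)
    next
      case False
      then have "\<not> (p \<le> r \<and> r \<le> q)"
        using S True unfolding order_convex_def by blast
      moreover have "p \<le> r" if "g $ p $ r \<noteq> 0"
        using UT_entry[OF g that] by auto
      moreover have "r \<le> q" if "X $ r $ q \<noteq> 0"
        using X that unfolding mem_nil_alg by (simp add: less_imp_le)
      ultimately have "g $ p $ r = 0 \<or> X $ r $ q = 0"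
        by blast
      with False show ?thesis by (auto simp: proj_entry)
    qed
    with True show ?thesis
      by (simp add: proj_entry matrix_mult_entry)
  next
    case False
    have "(uproj S g ** proj S X) $ p $ q = 0"
      unfolding matrix_mult_entry
      by (rule sum.neutral) (use False in \<open>auto simp: uproj_entry[OF g] proj_entry\<close>)
    with False show ?thesis
      by (auto simp: proj_entry)
  qed
  then show ?thesis by (simp add: vec_eq_iff)
qed

lemma proj_mult_UT:
  assumes S: "order_convex S" and h: "h \<in> UT UNIV" and X: "X \<in> nil_alg UNIV"
  shows "proj S (X ** h) = proj S X ** uproj S h"
proof -
  have "proj S (X ** h) $ p $ q = (proj S X ** uproj S h) $ p $ q" for p q
  proof (cases "p \<in> S \<and> q \<in> S")
    case True
    have "X $ p $ r * h $ r $ q = proj S X $ p $ r * uproj S h $ r $ q" for r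
    proof (cases "r \<in> S")
      case True
      then show ?thesis
        using \<open>p \<in> S \<and> q \<in> S\<close> UT_diag[OF h] by (simp add: uproj_entry[OF h] proj_entry)
    next
      case False
      then have "\<not> (p \<le> r \<and> r \<le> q)"
        using S True unfolding order_convex_def by blast
      moreover have "r \<le> q" if "h $ r $ q \<noteq> 0"
        using UT_entry[OF h that] by auto
      moreover have "p \<le> r" if "X $ p $ r \<noteq> 0"
        using X that unfolding mem_nil_alg by (simp add: less_imp_le)
      ultimately have "X $ p $ r = 0 \<or> h $ r $ q = 0"
        by blast
      with False show ?thesis by (auto simp: proj_entry)
    qed
    with True show ?thesis
      by (simp add: proj_entry matrix_mult_entry)
  next
    case False
    have "(proj S X ** uproj S h) $ p $ q = 0"
      unfolding matrix_mult_entry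
      by (rule sum.neutral) (use False in \<open>auto simp: uproj_entry[OF h] proj_entry\<close>)
    with False show ?thesis
      by (auto simp: proj_entry)
  qed
  then show ?thesis by (simp add: vec_eq_iff)
qed

lemma proj_two_sided:
  assumes "order_convex S" "g \<in> UT UNIV" "h \<in> UT UNIV" "X \<in> nil_alg UNIV"
  shows "proj S (g ** X ** h) = uproj S g ** proj S X ** uproj S h"
  using assms by (simp add: proj_mult_UT proj_UT_mult UT_mult_nil_alg)

abbreviation pullback where
  "pullback S \<mu> \<equiv> compose (nil_alg UNIV) \<mu> (proj S)"

lemma pullback_inj:
  fixes S :: "'n::{finite,linorder} set"
  shows "inj_on (pullback S :: (('a::{field,finite}, 'n) sqmat \<Rightarrow> 'a) \<Rightarrow> _)
    (extensional (nil_alg S))"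
proof (rule inj_onI)
  fix \<mu> \<nu> :: "('a, 'n) sqmat \<Rightarrow> 'a"
  assume ext: "\<mu> \<in> extensional (nil_alg S)" "\<nu> \<in> extensional (nil_alg S)"
    and eq: "pullback S \<mu> = pullback S \<nu>"
  have "\<mu> X = \<nu> X" if X: "X \<in> nil_alg S" for X :: "('a, 'n) sqmat"
  proof -
    have "X \<in> nil_alg UNIV" using X nil_alg_mono by blast
    then show ?thesis
      using fun_cong[OF eq, of X] X by (simp add: compose_def proj_id)
  qed
  then show "\<mu> = \<nu>" using ext by (intro extensionalityI)
qed

lemma twist_pullback:
  assumes "order_convex S" "g \<in> UT UNIV" "h \<in> UT UNIV"
  shows "twist UNIV g h (pullback S \<mu>) = pullback S (twist S (uproj S g) (uproj S h) \<mu>)"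
  unfolding twist_def compose_def
  by (rule restrict_ext) (simp add: assms nil_alg_two_sided proj_two_sided proj_nil_alg)

lemma two_sided_orbit_pullback:
  assumes S: "order_convex S"
  shows "two_sided_orbit UNIV (pullback S \<mu>) = pullback S ` two_sided_orbit S \<mu>"
proof -
  have "two_sided_orbit UNIV (pullback S \<mu>) =
      (\<lambda>(g, h). twist UNIV g h (pullback S \<mu>)) ` (UT UNIV \<times> UT UNIV)"
    unfolding two_sided_orbit_eq by auto
  also have "\<dots> = (\<lambda>(g, h). pullback S (twist S g h \<mu>)) ` (uproj S ` UT UNIV \<times> uproj S ` UT UNIV)"
    by (force simp: twist_pullback[OF S] image_iff)
  also have "\<dots> = pullback S ` two_sided_orbit S \<mu>"
    unfolding two_sided_orbit_eq uproj_image by auto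
  finally show ?thesis .
qed

lemma right_orbit_pullback:
  assumes S: "order_convex S"
  shows "right_orbit UNIV (pullback S \<mu>) = pullback S ` right_orbit S \<mu>"
proof -
  have one: "uproj S (mat 1) = mat 1"
    by (intro uproj_id one_in_UT)
  have "right_orbit UNIV (pullback S \<mu>) = (\<lambda>h. twist UNIV (mat 1) h (pullback S \<mu>)) ` UT UNIV"
    unfolding right_orbit_eq by auto
  also have "\<dots> = (\<lambda>h. pullback S (twist S (mat 1) h \<mu>)) ` (uproj S ` UT UNIV)"
    by (force simp: twist_pullback[OF S] image_iff one one_in_UT)
  also have "\<dots> = pullback S ` right_orbit S \<mu>"
    unfolding right_orbit_eq uproj_image by auto
  finally show ?thesis .
qed

text \<open>Pulling functionals back along the projection is injective and, as the group maps onto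
  \<^term>\<open>UT S\<close>, carries orbits onto orbits; so neither the cardinalities nor the orbit sum change.\<close>

lemma superchar_pullback:
  assumes S: "order_convex S" and u: "u \<in> UT UNIV"
  shows "superchar \<theta> UNIV (pullback S \<mu>) u = superchar \<theta> S \<mu> (uproj S u)"
proof -
  have "two_sided_orbit S \<mu> \<subseteq> extensional (nil_alg S)"
    "right_orbit S \<mu> \<subseteq> extensional (nil_alg S)"
    unfolding two_sided_orbit_eq right_orbit_eq twist_def by auto
  then have inj: "inj_on (pullback S) (two_sided_orbit S \<mu>)"
    "inj_on (pullback S) (right_orbit S \<mu>)"
    using inj_on_subset[OF pullback_inj] by blast+
  have "u - mat 1 \<in> nil_alg UNIV"
    using u by (simp add: UT_iff)
  then have "(\<Sum>\<nu>\<in>pullback S ` two_sided_orbit S \<mu>. \<theta> (\<nu> (u - mat 1))) =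
      (\<Sum>\<nu>\<in>two_sided_orbit S \<mu>. \<theta> (\<nu> (uproj S u - mat 1)))"
    by (simp add: sum.reindex[OF inj(1)] compose_eq uproj_def)
  then show ?thesis
    using uproj_UT[OF u, of S] u
    by (simp add: superchar_def two_sided_orbit_pullback[OF S] right_orbit_pullback[OF S]
        card_image inj)
qed

context additive_character
begin

lemma inflation_is_Sinf:
  assumes S: "order_convex S"
  shows "is_Sinf \<theta> S (\<lambda>\<phi>\<in>superclass_functions S. \<lambda>u\<in>UT UNIV. \<phi> (uproj S u))"
    (is "is_Sinf \<theta> S ?T")
proof -
  have "(\<lambda>u\<in>UT UNIV. \<phi> (uproj S u)) \<in> superclass_functions UNIV"
    if "\<phi> \<in> superclass_functions S" for \<phi>
    using that unfolding superclass_functions_iff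
    by (simp add: one_plus_UT_iff nil_alg_two_sided uproj_one_plus proj_two_sided[OF S]
        proj_nil_alg uproj_UT)
  then have "?T \<in> superclass_functions S \<rightarrow>\<^sub>E superclass_functions UNIV"
    by (intro PiE_I) simp_all
  moreover have "?T (superchar \<theta> S \<mu>) = superchar \<theta> UNIV (pullback S \<mu>)" if "\<mu> \<in> dual S" for \<mu>
    by (rule extensionalityI[of _ "UT UNIV"])
      (simp_all add: superchar_superclass_function that superchar_pullback[OF S],
        simp add: superchar_def)
  ultimately show ?thesis
    unfolding is_Sinf_def
    by (auto simp: superclass_functions_add superclass_functions_scale uproj_UT
        cong: restrict_cong)
qed

lemma Sinf_eq_inflation:
  assumes "order_convex S" "\<phi> \<in> superclass_functions S" "u \<in> UT UNIV"
  shows "Sinf \<theta> S \<phi> u = \<phi> (uproj S u)"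
proof -
  have "Sinf \<theta> S = (\<lambda>\<phi>\<in>superclass_functions S. \<lambda>u\<in>UT UNIV. \<phi> (uproj S u))"
    unfolding Sinf_def
    by (rule the_equality) (use inflation_is_Sinf[OF assms(1)] is_Sinf_unique in blast)+
  then show ?thesis using assms by simp
qed

lemma SinfRes_apply:
  assumes "order_convex S" "\<psi> \<in> superclass_functions UNIV" "u \<in> UT UNIV"
  shows "SinfRes \<theta> S \<psi> u = \<psi> (uproj S u)"
  using assms by (simp add: SinfRes_def Sinf_eq_inflation superclass_functions_restrict uproj_UT)

lemma arc_char_superclass_function: "arc_char \<theta> i a l \<in> superclass_functions UNIV"
  unfolding arc_char_def
proof (rule superchar_superclass_function)
  show "arc_fun i a l \<in> dual UNIV"
    unfolding dual_def arc_fun_def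
    by (auto simp: nil_alg_add nil_alg_scale nth_map_matrix algebra_simps)
qed

end

section \<open>The supercharacter of a single arc\<close>

text \<open>These are the possible rows \<open>i\<close> (with \<open>e = i\<close>) and columns \<open>l\<close> (with \<open>e = l\<close>) of a unipotent
  matrix, cut down to the positions that can meet an entry of \<open>X\<close> in an arc functional.\<close>

definition pivot_vecs :: "'n \<Rightarrow> 'n set \<Rightarrow> ('n \<Rightarrow> 'a::zero_neq_one) set" where
  "pivot_vecs e J = {t. t e = 1 \<and> (\<forall>q. q \<notin> insert e J \<longrightarrow> t q = 0)}"

lemma pivot_vecsD:
  assumes "t \<in> pivot_vecs e J"
  shows "t e = 1" "q \<notin> insert e J \<Longrightarrow> t q = 0"
  using assms unfolding pivot_vecs_def by blast+

lemma row_vec_zero: "s \<in> pivot_vecs i {i<..<l} \<Longrightarrow> i < l \<Longrightarrow> p \<notin> {i..<l} \<Longrightarrow> s p = 0"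
  for i l :: "'n::linorder"
  unfolding pivot_vecs_def by auto

lemma col_vec_zero: "t \<in> pivot_vecs l {i<..<l} \<Longrightarrow> i < l \<Longrightarrow> q \<notin> {i<..l} \<Longrightarrow> t q = 0"
  for i l :: "'n::linorder"
  unfolding pivot_vecs_def by auto

lemma card_pivot_vecs_cong:
  fixes e f :: 'n
  assumes "e \<notin> J" "f \<notin> J"
  shows "card (pivot_vecs e J :: ('n \<Rightarrow> 'a::zero_neq_one) set) =
    card (pivot_vecs f J :: ('n \<Rightarrow> 'a) set)"
proof (rule bij_betw_same_card)
  let ?\<tau> = "Transposition.transpose e f"
  show "bij_betw (\<lambda>t. t \<circ> ?\<tau>) (pivot_vecs e J :: ('n \<Rightarrow> 'a) set) (pivot_vecs f J)"
  proof (rule bij_betw_byWitness[where f' = "\<lambda>t. t \<circ> ?\<tau>"])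
    show "(\<lambda>t. t \<circ> ?\<tau>) ` (pivot_vecs e J :: ('n \<Rightarrow> 'a) set) \<subseteq> pivot_vecs f J"
      "(\<lambda>t. t \<circ> ?\<tau>) ` (pivot_vecs f J :: ('n \<Rightarrow> 'a) set) \<subseteq> pivot_vecs e J"
      using assms unfolding pivot_vecs_def by (auto simp: Transposition.transpose_def)
  qed (simp_all add: comp_assoc)
qed

lemma pivot_sum:
  fixes y :: "'n::finite \<Rightarrow> 'a::comm_semiring_1"
  assumes s: "s \<in> pivot_vecs e J" and y: "\<And>p. p \<in> J \<Longrightarrow> p \<noteq> e \<Longrightarrow> y p = 0"
  shows "(\<Sum>p\<in>UNIV. s p * y p) = y e"
proof -
  have "(\<Sum>p\<in>UNIV. s p * y p) = (\<Sum>p\<in>UNIV. if p = e then y p else 0)"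
  proof (rule sum.cong[OF refl])
    fix p
    show "s p * y p = (if p = e then y p else 0)"
      using pivot_vecsD[OF s] y[of p] by (cases "p \<in> J") auto
  qed
  then show ?thesis by simp
qed

definition arc_form :: "'a \<Rightarrow> ('n \<Rightarrow> 'a) \<Rightarrow> ('n \<Rightarrow> 'a) \<Rightarrow>
    ('a::{field,finite}, 'n::{finite,linorder}) sqmat \<Rightarrow> 'a" where
  "arc_form a s t = (\<lambda>X\<in>nil_alg UNIV. a * (\<Sum>p\<in>UNIV. \<Sum>q\<in>UNIV. s p * X $ p $ q * t q))"

definition row_part :: "'n \<Rightarrow> 'n \<Rightarrow> ('a::{field,finite}, 'n::{finite,linorder}) sqmat \<Rightarrow> 'n \<Rightarrow> 'a"
  where "row_part i l g = (\<lambda>p. if p \<in> {i..<l} then g $ i $ p else 0)"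

definition col_part :: "'n \<Rightarrow> 'n \<Rightarrow> ('a::{field,finite}, 'n::{finite,linorder}) sqmat \<Rightarrow> 'n \<Rightarrow> 'a"
  where "col_part i l h = (\<lambda>q. if q \<in> {i<..l} then h $ q $ l else 0)"

text \<open>A nonzero entry of a strictly upper-triangular matrix has its row before its column; so only
  the part of row \<open>i\<close> of \<open>g\<close> before \<open>l\<close>, and the part of column \<open>l\<close> of \<open>h\<close> after \<open>i\<close>, matter.\<close>

lemma twist_arc_fun:
  assumes "g \<in> UT UNIV" "h \<in> UT UNIV"
  shows "twist UNIV g h (arc_fun i a l) = arc_form a (row_part i l g) (col_part i l h)"
  unfolding twist_def arc_form_def
proof (rule restrict_ext)
  fix X :: "('a, 'b) sqmat"
  assume X: "X \<in> nil_alg UNIV"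
  have entry: "g $ i $ p * X $ p $ q * h $ q $ l = row_part i l g p * X $ p $ q * col_part i l h q"
    for p q
  proof (cases "g $ i $ p = 0 \<or> X $ p $ q = 0 \<or> h $ q $ l = 0")
    case True
    then show ?thesis by (auto simp: row_part_def col_part_def)
  next
    case False
    then have "i \<le> p" "p < q" "q \<le> l"
      using UT_entry[OF assms(1), of i p] UT_entry[OF assms(2), of q l] X
      unfolding mem_nil_alg by auto
    then show ?thesis by (auto simp: row_part_def col_part_def)
  qed
  have "(g ** X ** h) $ i $ l = (\<Sum>q\<in>UNIV. \<Sum>p\<in>UNIV. g $ i $ p * X $ p $ q * h $ q $ l)"
    by (simp add: matrix_mult_entry sum_distrib_right)
  also have "\<dots> = (\<Sum>p\<in>UNIV. \<Sum>q\<in>UNIV. row_part i l g p * X $ p $ q * col_part i l h q)"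
    unfolding entry by (rule sum.swap)
  finally show "arc_fun i a l (g ** X ** h) =
      a * (\<Sum>p\<in>UNIV. \<Sum>q\<in>UNIV. row_part i l g p * X $ p $ q * col_part i l h q)"
    by (simp add: arc_fun_def nil_alg_two_sided assms X)
qed

lemma row_part_image:
  fixes i l :: "'n::{finite,linorder}"
  assumes "i < l"
  shows "row_part i l ` UT UNIV = (pivot_vecs i {i<..<l} :: ('n \<Rightarrow> 'a::{field,finite}) set)"
proof
  show "row_part i l ` UT UNIV \<subseteq> (pivot_vecs i {i<..<l} :: ('n \<Rightarrow> 'a) set)"
    using assms by (auto simp: row_part_def pivot_vecs_def UT_diag)
  show "(pivot_vecs i {i<..<l} :: ('n \<Rightarrow> 'a) set) \<subseteq> row_part i l ` UT UNIV"
  proof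
    fix s :: "'n \<Rightarrow> 'a"
    assume s: "s \<in> pivot_vecs i {i<..<l}"
    define g :: "('a, 'n) sqmat" where
      "g = (\<chi> p q. if p = q then 1 else if p = i then s q else 0)"
    have "s q = 0" if "q < i" for q
      using that by (intro row_vec_zero[OF s assms]) auto
    then have "g \<in> UT UNIV"
      unfolding UT_def g_def by auto
    moreover have "s p = row_part i l g p" for p
      using pivot_vecsD(1)[OF s] row_vec_zero[OF s assms, of p]
      by (cases "p \<in> {i..<l}") (auto simp: row_part_def g_def)
    then have "s = row_part i l g" ..
    ultimately show "s \<in> row_part i l ` UT UNIV" by blast
  qed
qed

lemma col_part_image:
  fixes i l :: "'n::{finite,linorder}"
  assumes "i < l"
  shows "col_part i l ` UT UNIV = (pivot_vecs l {i<..<l} :: ('n \<Rightarrow> 'a::{field,finite}) set)"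
proof
  show "col_part i l ` UT UNIV \<subseteq> (pivot_vecs l {i<..<l} :: ('n \<Rightarrow> 'a) set)"
    using assms by (auto simp: col_part_def pivot_vecs_def UT_diag)
  show "(pivot_vecs l {i<..<l} :: ('n \<Rightarrow> 'a) set) \<subseteq> col_part i l ` UT UNIV"
  proof
    fix t :: "'n \<Rightarrow> 'a"
    assume t: "t \<in> pivot_vecs l {i<..<l}"
    define h :: "('a, 'n) sqmat" where
      "h = (\<chi> p q. if p = q then 1 else if q = l then t p else 0)"
    have "t p = 0" if "l < p" for p
      using that by (intro col_vec_zero[OF t assms]) auto
    then have "h \<in> UT UNIV"
      unfolding UT_def h_def by auto
    moreover have "t q = col_part i l h q" for q
      using pivot_vecsD(1)[OF t] col_vec_zero[OF t assms, of q]
      by (cases "q \<in> {i<..l}") (auto simp: col_part_def h_def)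
    then have "t = col_part i l h" ..
    ultimately show "t \<in> col_part i l ` UT UNIV" by blast
  qed
qed

lemma arc_two_sided_orbit:
  assumes "i < l"
  shows "two_sided_orbit UNIV (arc_fun i a l) =
    (\<lambda>(s, t). arc_form a s t) ` (pivot_vecs i {i<..<l} \<times> pivot_vecs l {i<..<l})"
proof -
  have "two_sided_orbit UNIV (arc_fun i a l) =
      (\<lambda>(g, h). twist UNIV g h (arc_fun i a l)) ` (UT UNIV \<times> UT UNIV)"
    unfolding two_sided_orbit_eq by auto
  also have "\<dots> = (\<lambda>(g, h). arc_form a (row_part i l g) (col_part i l h)) ` (UT UNIV \<times> UT UNIV)"
    by (rule image_cong) (auto simp: twist_arc_fun)
  also have "\<dots> = (\<lambda>(s, t). arc_form a s t) ` (row_part i l ` UT UNIV \<times> col_part i l ` UT UNIV)"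
    by force
  finally show ?thesis
    unfolding row_part_image[OF assms] col_part_image[OF assms] .
qed

lemma arc_right_orbit:
  assumes "i < l"
  shows "right_orbit UNIV (arc_fun i a l) =
    arc_form a (row_part i l (mat 1)) ` pivot_vecs l {i<..<l}"
proof -
  have "right_orbit UNIV (arc_fun i a l) =
      (\<lambda>h. twist UNIV (mat 1) h (arc_fun i a l)) ` UT UNIV"
    unfolding right_orbit_eq by auto
  also have "\<dots> = (\<lambda>h. arc_form a (row_part i l (mat 1)) (col_part i l h)) ` UT UNIV"
    by (rule image_cong) (auto simp: twist_arc_fun one_in_UT)
  finally show ?thesis
    unfolding col_part_image[OF assms, symmetric] image_image .
qed

text \<open>A bilinear form is recovered from its values on elementary matrices.\<close>

lemma arc_form_inj:
  fixes i l :: "'n::{finite,linorder}" and a :: "'a::{field,finite}"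
  assumes "i < l" "a \<noteq> 0"
  shows "inj_on (\<lambda>(s, t). arc_form a s t) (pivot_vecs i {i<..<l} \<times> pivot_vecs l {i<..<l})"
proof -
  have el: "arc_form a s t (\<chi> x y. if x = p \<and> y = q then 1 else 0) = a * (s p * t q)"
    if "p < q" for p q :: 'n and s t
  proof -
    have "(\<Sum>y\<in>UNIV. s x * (if x = p \<and> y = q then 1 else 0) * t y) =
        (\<Sum>y\<in>UNIV. if y = q then (if x = p then s x * t y else 0) else 0)" for x
      by (intro sum.cong refl) simp
    then show ?thesis
      using that by (simp add: arc_form_def mem_nil_alg)
  qed
  have "s = s' \<and> t = t'"
    if s: "s \<in> pivot_vecs i {i<..<l}" "s' \<in> pivot_vecs i {i<..<l}"
      and t: "t \<in> pivot_vecs l {i<..<l}" "t' \<in> pivot_vecs l {i<..<l}"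
      and eq: "arc_form a s t = arc_form a s' t'" for s s' t t'
  proof -
    have prods: "s p * t q = s' p * t' q" if "p < q" for p q
      using el[OF that, of s t] el[OF that, of s' t'] eq assms(2) by simp
    have "s p = s' p" for p
    proof (cases "p \<in> insert i {i<..<l}")
      case True
      then have "p < l" using assms(1) by auto
      then show ?thesis
        using prods[of p l] pivot_vecsD(1)[OF t(1)] pivot_vecsD(1)[OF t(2)] by simp
    qed (simp add: pivot_vecsD(2)[OF s(1)] pivot_vecsD(2)[OF s(2)])
    moreover have "t q = t' q" for q
    proof (cases "q \<in> insert l {i<..<l}")
      case True
      then have "i < q" using assms(1) by auto
      then show ?thesis
        using prods[of i q] pivot_vecsD(1)[OF s(1)] pivot_vecsD(1)[OF s(2)] by simp
    qed (simp add: pivot_vecsD(2)[OF t(1)] pivot_vecsD(2)[OF t(2)])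
    ultimately show ?thesis by blast
  qed
  then show ?thesis
    by (auto simp: inj_on_def)
qed

text \<open>Consider the square block of \<open>X\<close> with rows and columns in \<open>{i<..<l}\<close>.  Because the pivot
  coordinate is 1, the next two sets describe the solutions of an inhomogeneous linear system
  with this block as its matrix, and with column \<open>l\<close>, respectively row \<open>i\<close>, as its right-hand side
  (up to sign).\<close>

definition col_sols :: "('a::{field,finite}, 'n::{finite,linorder}) sqmat \<Rightarrow> 'n \<Rightarrow> 'n \<Rightarrow> ('n \<Rightarrow> 'a) set"
  where "col_sols X i l =
    {t \<in> pivot_vecs l {i<..<l}. \<forall>p\<in>{i<..<l}. (\<Sum>q\<in>UNIV. X $ p $ q * t q) = 0}"

definition row_sols :: "('a::{field,finite}, 'n::{finite,linorder}) sqmat \<Rightarrow> 'n \<Rightarrow> 'n \<Rightarrow> ('n \<Rightarrow> 'a) set"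
  where "row_sols X i l =
    {s \<in> pivot_vecs i {i<..<l}. \<forall>q\<in>{i<..<l}. (\<Sum>p\<in>UNIV. s p * X $ p $ q) = 0}"

context additive_character
begin

lemma sum_theta_pivot:
  fixes y :: "'n::finite \<Rightarrow> 'a"
  assumes "e \<notin> J" "a \<noteq> 0"
  shows "(\<Sum>s\<in>pivot_vecs e J. \<theta> (a * (\<Sum>p\<in>UNIV. s p * y p))) =
    (if \<forall>p\<in>J. y p = 0 then of_nat (card (pivot_vecs e J :: ('n \<Rightarrow> 'a) set)) * \<theta> (a * y e) else 0)"
proof (cases "\<forall>p\<in>J. y p = 0")
  case True
  then show ?thesis by (simp add: pivot_sum)
next
  case False
  then obtain r where r: "r \<in> J" "y r \<noteq> 0" by blast
  obtain x where x: "\<theta> x \<noteq> 1" using nontrivial by blast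
  \<comment> \<open>Adding \<open>d\<close> to coordinate \<open>r\<close> raises the argument of \<open>\<theta>\<close> by \<open>x\<close>.\<close>
  define d where "d = x / (a * y r)"
  have "bij_betw (\<lambda>s. s(r := s r + d)) (pivot_vecs e J) (pivot_vecs e J)"
    by (rule bij_betw_byWitness[where f' = "\<lambda>s. s(r := s r - d)"])
      (use assms(1) r(1) in \<open>auto simp: pivot_vecs_def\<close>)
  moreover have "a * (\<Sum>p\<in>UNIV. (s(r := s r + d)) p * y p) = a * (\<Sum>p\<in>UNIV. s p * y p) + x" for s
  proof -
    have "(\<Sum>p\<in>UNIV. (s(r := s r + d)) p * y p) =
        (\<Sum>p\<in>UNIV. s p * y p + (if p = r then d * y p else 0))"
      by (intro sum.cong refl) (auto simp: algebra_simps)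
    also have "\<dots> = (\<Sum>p\<in>UNIV. s p * y p) + d * y r"
      by (simp add: sum.distrib)
    finally show ?thesis
      using assms(2) r(2) by (simp add: d_def distrib_left)
  qed
  ultimately have "(\<Sum>s\<in>pivot_vecs e J. \<theta> (a * (\<Sum>p\<in>UNIV. s p * y p))) = 0"
    using sum_theta_shift_zero[where F = "\<lambda>s. a * (\<Sum>p\<in>UNIV. s p * y p)"] x by blast
  with False show ?thesis by auto
qed

text \<open>The orbit is parametrised bijectively by the pairs \<open>(s, t)\<close> and the right orbit by \<open>t\<close> alone, so
  the normalising factor of the supercharacter is the inverse of the number of vectors \<open>s\<close>.\<close>

lemma arc_char_bilinear:
  fixes i l :: "'n::{finite,linorder}"
  assumes "i < l" "a \<noteq> 0" "u \<in> UT UNIV"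
  shows "of_nat (card (pivot_vecs i {i<..<l} :: ('n \<Rightarrow> 'a) set)) * arc_char \<theta> i a l u =
    (\<Sum>s\<in>pivot_vecs i {i<..<l}. \<Sum>t\<in>pivot_vecs l {i<..<l}.
      \<theta> (a * (\<Sum>p\<in>UNIV. \<Sum>q\<in>UNIV. s p * (u - mat 1) $ p $ q * t q)))"
proof -
  let ?P = "pivot_vecs i {i<..<l} :: ('n \<Rightarrow> 'a) set"
  let ?Q = "pivot_vecs l {i<..<l} :: ('n \<Rightarrow> 'a) set"
  have nonempty: "(\<lambda>p. if p = e then 1 else 0) \<in> pivot_vecs e J" for e and J :: "'n set"
    by (simp add: pivot_vecs_def)
  then have card: "card ?P \<noteq> 0" "card ?Q \<noteq> 0" by auto
  note inj = arc_form_inj[OF assms(1,2)]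
  have "row_part i l (mat 1) \<in> ?P"
    unfolding row_part_image[OF assms(1), symmetric] using one_in_UT by blast
  then have inj_right: "inj_on (arc_form a (row_part i l (mat 1))) ?Q"
    using inj by (auto simp: inj_on_def)
  have X: "u - mat 1 \<in> nil_alg UNIV" using assms(3) by (simp add: UT_iff)
  have "card (two_sided_orbit UNIV (arc_fun i a l)) = card ?P * card ?Q"
    by (simp add: arc_two_sided_orbit[OF assms(1)] card_image[OF inj] card_cartesian_product)
  moreover have "card (right_orbit UNIV (arc_fun i a l)) = card ?Q"
    by (simp add: arc_right_orbit[OF assms(1)] card_image[OF inj_right])
  moreover have "(\<Sum>\<mu>\<in>two_sided_orbit UNIV (arc_fun i a l). \<theta> (\<mu> (u - mat 1))) =
      (\<Sum>s\<in>?P. \<Sum>t\<in>?Q. \<theta> (arc_form a s t (u - mat 1)))"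
    unfolding arc_two_sided_orbit[OF assms(1)] sum.reindex[OF inj] sum.cartesian_product
    by (simp add: case_prod_unfold)
  ultimately show ?thesis
    using card assms(3) X by (simp add: arc_char_def superchar_def arc_form_def)
qed

text \<open>Each of the two formulas below comes from summing the bilinear formula over one of the two
  vectors first: by orthogonality only the solutions of a linear system survive.  Having both of
  them shows that the character vanishes as soon as one of the two systems is inconsistent.\<close>

lemma arc_char_col_sols:
  fixes i l :: "'n::{finite,linorder}"
  assumes "i < l" "a \<noteq> 0" "u \<in> UT UNIV"
  shows "arc_char \<theta> i a l u =
    (\<Sum>t\<in>col_sols (u - mat 1) i l. \<theta> (a * (\<Sum>q\<in>UNIV. (u - mat 1) $ i $ q * t q)))"
proof -
  let ?P = "pivot_vecs i {i<..<l} :: ('n \<Rightarrow> 'a) set"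
  let ?Q = "pivot_vecs l {i<..<l} :: ('n \<Rightarrow> 'a) set"
  define y where "y t p = (\<Sum>q\<in>UNIV. (u - mat 1) $ p $ q * t q)" for t p
  have "of_nat (card ?P) * arc_char \<theta> i a l u =
      (\<Sum>t\<in>?Q. \<Sum>s\<in>?P. \<theta> (a * (\<Sum>p\<in>UNIV. s p * y t p)))"
    unfolding arc_char_bilinear[OF assms] y_def
    by (subst sum.swap) (simp add: sum_distrib_left mult.assoc)
  also have "\<dots> = (\<Sum>t\<in>?Q. if \<forall>p\<in>{i<..<l}. y t p = 0 then of_nat (card ?P) * \<theta> (a * y t i) else 0)"
    by (intro sum.cong refl sum_theta_pivot assms) simp
  also have "\<dots> = (\<Sum>t\<in>col_sols (u - mat 1) i l. of_nat (card ?P) * \<theta> (a * y t i))"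
    unfolding col_sols_def y_def by (rule sum.inter_filter[symmetric]) simp
  also have "\<dots> = of_nat (card ?P) * (\<Sum>t\<in>col_sols (u - mat 1) i l. \<theta> (a * y t i))"
    by (simp add: sum_distrib_left)
  finally have "of_nat (card ?P) * arc_char \<theta> i a l u = \<dots>" .
  moreover have "(\<lambda>p. if p = i then 1 else 0) \<in> ?P"
    by (simp add: pivot_vecs_def)
  then have "card ?P \<noteq> 0" by auto
  ultimately show ?thesis
    unfolding y_def by simp
qed

lemma arc_char_row_sols:
  fixes i l :: "'n::{finite,linorder}"
  assumes "i < l" "a \<noteq> 0" "u \<in> UT UNIV"
  shows "arc_char \<theta> i a l u =
    (\<Sum>s\<in>row_sols (u - mat 1) i l. \<theta> (a * (\<Sum>p\<in>UNIV. s p * (u - mat 1) $ p $ l)))"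
proof -
  let ?P = "pivot_vecs i {i<..<l} :: ('n \<Rightarrow> 'a) set"
  let ?Q = "pivot_vecs l {i<..<l} :: ('n \<Rightarrow> 'a) set"
  define y where "y s q = (\<Sum>p\<in>UNIV. s p * (u - mat 1) $ p $ q)" for s q
  have form: "(\<Sum>p\<in>UNIV. \<Sum>q\<in>UNIV. s p * (u - mat 1) $ p $ q * t q) = (\<Sum>q\<in>UNIV. t q * y s q)"
    for s t
    unfolding y_def by (subst sum.swap) (simp add: sum_distrib_left ac_simps)
  have PQ: "card ?P = card ?Q"
    by (rule card_pivot_vecs_cong) simp_all
  have "of_nat (card ?P) * arc_char \<theta> i a l u =
      (\<Sum>s\<in>?P. \<Sum>t\<in>?Q. \<theta> (a * (\<Sum>q\<in>UNIV. t q * y s q)))"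
    unfolding arc_char_bilinear[OF assms] form ..
  also have "\<dots> = (\<Sum>s\<in>?P. if \<forall>q\<in>{i<..<l}. y s q = 0 then of_nat (card ?Q) * \<theta> (a * y s l) else 0)"
    by (intro sum.cong refl sum_theta_pivot assms) simp
  also have "\<dots> = (\<Sum>s\<in>row_sols (u - mat 1) i l. of_nat (card ?Q) * \<theta> (a * y s l))"
    unfolding row_sols_def y_def by (rule sum.inter_filter[symmetric]) simp
  also have "\<dots> = of_nat (card ?P) * (\<Sum>s\<in>row_sols (u - mat 1) i l. \<theta> (a * y s l))"
    by (simp add: sum_distrib_left PQ)
  finally have "of_nat (card ?P) * arc_char \<theta> i a l u = \<dots>" .
  moreover have "(\<lambda>p. if p = i then 1 else 0) \<in> ?P"
    by (simp add: pivot_vecs_def)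
  then have "card ?P \<noteq> 0" by auto
  ultimately show ?thesis
    unfolding y_def by simp
qed

text \<open>Both sides are equal to \<open>s X t\<close>, because in \<open>X t\<close> and in \<open>s X\<close> only the pivot coordinate of the
  other vector matters.\<close>

lemma sols_pairing:
  assumes t: "t \<in> col_sols X i l" and s: "s \<in> row_sols X i l"
  shows "(\<Sum>q\<in>UNIV. X $ i $ q * t q) = (\<Sum>p\<in>UNIV. s p * X $ p $ l)"
proof -
  have "(\<Sum>q\<in>UNIV. X $ i $ q * t q) = (\<Sum>p\<in>UNIV. s p * (\<Sum>q\<in>UNIV. X $ p $ q * t q))"
    using s t pivot_sum[of s i "{i<..<l}" "\<lambda>p. \<Sum>q\<in>UNIV. X $ p $ q * t q"]
    unfolding row_sols_def col_sols_def by simp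
  also have "\<dots> = (\<Sum>q\<in>UNIV. t q * (\<Sum>p\<in>UNIV. s p * X $ p $ q))"
    unfolding sum_distrib_left by (subst sum.swap) (simp add: ac_simps)
  also have "\<dots> = (\<Sum>p\<in>UNIV. s p * X $ p $ l)"
    using s t pivot_sum[of t l "{i<..<l}" "\<lambda>q. \<Sum>p\<in>UNIV. s p * X $ p $ q"]
    unfolding row_sols_def col_sols_def by simp
  finally show ?thesis .
qed

lemma arc_char_consistent:
  assumes "i < l" "a \<noteq> 0" "u \<in> UT UNIV"
    and t: "t \<in> col_sols (u - mat 1) i l" and s: "s \<in> row_sols (u - mat 1) i l"
  shows "arc_char \<theta> i a l u =
      of_nat (card (col_sols (u - mat 1) i l)) * \<theta> (a * (\<Sum>p\<in>UNIV. s p * (u - mat 1) $ p $ l))"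
    "arc_char \<theta> i a l u =
      of_nat (card (row_sols (u - mat 1) i l)) * \<theta> (a * (\<Sum>p\<in>UNIV. s p * (u - mat 1) $ p $ l))"
proof -
  show "arc_char \<theta> i a l u =
      of_nat (card (col_sols (u - mat 1) i l)) * \<theta> (a * (\<Sum>p\<in>UNIV. s p * (u - mat 1) $ p $ l))"
    unfolding arc_char_col_sols[OF assms(1-3)] by (simp only: sols_pairing[OF _ s] sum_constant
        cong: sum.cong)
  show "arc_char \<theta> i a l u =
      of_nat (card (row_sols (u - mat 1) i l)) * \<theta> (a * (\<Sum>p\<in>UNIV. s p * (u - mat 1) $ p $ l))"
    unfolding arc_char_row_sols[OF assms(1-3)] by (simp only: sols_pairing[OF t, symmetric]
        sols_pairing[OF t s, symmetric] sum_constant cong: sum.cong)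
qed

lemma arc_char_inconsistent:
  assumes "i < l" "a \<noteq> 0" "u \<in> UT UNIV"
    and "col_sols (u - mat 1) i l = {} \<or> row_sols (u - mat 1) i l = {}"
  shows "arc_char \<theta> i a l u = 0"
  using assms(4) arc_char_col_sols[OF assms(1-3)] arc_char_row_sols[OF assms(1-3)] by auto

end

section \<open>Single arcs after projection\<close>

lemma uproj_minus_one: "uproj S u - mat 1 = proj S (u - mat 1)"
  by (simp add: uproj_def)

lemma uproj_UT_UNIV: "u \<in> UT UNIV \<Longrightarrow> uproj S u \<in> UT UNIV"
  using uproj_UT UT_mono[of S UNIV] by blast

lemma col_sols_proj:
  assumes "{i<..l} \<subseteq> S"
  shows "col_sols (proj S X) i l = col_sols X i l"
proof -
  have "(\<Sum>q\<in>UNIV. proj S X $ p $ q * t q) = (\<Sum>q\<in>UNIV. X $ p $ q * t q)"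
    if t: "t \<in> pivot_vecs l {i<..<l}" and p: "p \<in> {i<..<l}" for t p
  proof (rule sum.cong[OF refl])
    fix q
    show "proj S X $ p $ q * t q = X $ p $ q * t q"
      using p assms col_vec_zero[OF t, of q]
      by (cases "q \<in> {i<..l}") (auto simp: proj_entry subset_iff)
  qed
  then show ?thesis unfolding col_sols_def by auto
qed

lemma row_sols_proj:
  assumes "{i..<l} \<subseteq> S"
  shows "row_sols (proj S X) i l = row_sols X i l"
proof -
  have "(\<Sum>p\<in>UNIV. s p * proj S X $ p $ q) = (\<Sum>p\<in>UNIV. s p * X $ p $ q)"
    if s: "s \<in> pivot_vecs i {i<..<l}" and q: "q \<in> {i<..<l}" for s q
  proof (rule sum.cong[OF refl])
    fix p
    show "s p * proj S X $ p $ q = s p * X $ p $ q"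
      using q assms row_vec_zero[OF s, of p]
      by (cases "p \<in> {i..<l}") (auto simp: proj_entry subset_iff)
  qed
  then show ?thesis unfolding row_sols_def by auto
qed

text \<open>For \<open>S = {i<..<l}\<close> the projected system is the homogeneous system belonging to the middle block,
  and translation by a particular solution matches its solutions with those of the original one.\<close>

lemma card_col_sols_homogeneous:
  fixes X :: "('a::{field,finite}, 'n::{finite,linorder}) sqmat"
  assumes t0: "t0 \<in> col_sols X i l"
  shows "card (col_sols (proj {i<..<l} X) i l) = card (col_sols X i l)"
proof -
  let ?Y = "proj {i<..<l} X"
  let ?f = "\<lambda>(t :: 'n \<Rightarrow> 'a) q. if q = l then 1 else t q - t0 q"
  let ?g = "\<lambda>(t :: 'n \<Rightarrow> 'a) q. if q = l then 1 else t q + t0 q"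
  have piv: "t l = 1" "\<And>q. q \<notin> insert l {i<..<l} \<Longrightarrow> t q = 0"
    if "t \<in> col_sols Z i l" for t and Z :: "('a, 'n) sqmat"
    using that pivot_vecsD[of t l "{i<..<l}"] unfolding col_sols_def by auto
  have sol: "(\<Sum>q\<in>UNIV. Z $ p $ q * t q) = 0"
    if "t \<in> col_sols Z i l" "p \<in> {i<..<l}" for t p and Z :: "('a, 'n) sqmat"
    using that unfolding col_sols_def by blast
  have f: "?f t \<in> col_sols ?Y i l" if t: "t \<in> col_sols X i l" for t
  proof -
    have "(\<Sum>q\<in>UNIV. ?Y $ p $ q * ?f t q) = 0" if p: "p \<in> {i<..<l}" for p
    proof -
      have "(\<Sum>q\<in>UNIV. ?Y $ p $ q * ?f t q) =
          (\<Sum>q\<in>UNIV. X $ p $ q * t q - X $ p $ q * t0 q)"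
      proof (rule sum.cong[OF refl])
        fix q
        show "?Y $ p $ q * ?f t q = X $ p $ q * t q - X $ p $ q * t0 q"
          using piv(1)[OF t] piv(1)[OF t0] piv(2)[OF t, of q] piv(2)[OF t0, of q] p
          by (cases "q \<in> {i<..<l}"; cases "q = l") (auto simp: proj_entry algebra_simps)
      qed
      then show ?thesis
        by (simp add: sum_subtractf sol[OF t p] sol[OF t0 p])
    qed
    moreover have "?f t \<in> pivot_vecs l {i<..<l}"
      unfolding pivot_vecs_def using piv(2)[OF t] piv(2)[OF t0] by auto
    ultimately show ?thesis
      unfolding col_sols_def by blast
  qed
  have g: "?g t \<in> col_sols X i l" if t: "t \<in> col_sols ?Y i l" for t
  proof -
    have "(\<Sum>q\<in>UNIV. X $ p $ q * ?g t q) = 0" if p: "p \<in> {i<..<l}" for p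
    proof -
      have "(\<Sum>q\<in>UNIV. X $ p $ q * ?g t q) =
          (\<Sum>q\<in>UNIV. ?Y $ p $ q * t q + X $ p $ q * t0 q)"
      proof (rule sum.cong[OF refl])
        fix q
        show "X $ p $ q * ?g t q = ?Y $ p $ q * t q + X $ p $ q * t0 q"
          using piv(1)[OF t] piv(1)[OF t0] piv(2)[OF t, of q] piv(2)[OF t0, of q] p
          by (cases "q \<in> {i<..<l}"; cases "q = l") (auto simp: proj_entry algebra_simps)
      qed
      then show ?thesis
        by (simp add: sum.distrib sol[OF t p] sol[OF t0 p])
    qed
    moreover have "?g t \<in> pivot_vecs l {i<..<l}"
      unfolding pivot_vecs_def using piv(2)[OF t] piv(2)[OF t0] by auto
    ultimately show ?thesis
      unfolding col_sols_def by blast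
  qed
  have "bij_betw ?f (col_sols X i l) (col_sols ?Y i l)"
  proof (rule bij_betw_byWitness[where f' = ?g])
    show "\<forall>t\<in>col_sols X i l. ?g (?f t) = t"
    proof (intro ballI ext)
      fix t q assume t: "t \<in> col_sols X i l"
      show "?g (?f t) q = t q" using piv(1)[OF t] by simp
    qed
    show "\<forall>t\<in>col_sols ?Y i l. ?f (?g t) = t"
    proof (intro ballI ext)
      fix t q assume t: "t \<in> col_sols ?Y i l"
      show "?f (?g t) q = t q" using piv(1)[OF t] by simp
    qed
    show "?f ` col_sols X i l \<subseteq> col_sols ?Y i l"
      using f by (rule image_subsetI)
    show "?g ` col_sols ?Y i l \<subseteq> col_sols X i l"
      using g by (rule image_subsetI)
  qed
  from bij_betw_same_card[OF this] show ?thesis by simp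
qed

context additive_character
begin

lemma arc_char_uproj_no_row:
  assumes "i < l" "a \<noteq> 0" "u \<in> UT UNIV" "i \<notin> S"
  shows "arc_char \<theta> i a l (uproj S u) = of_nat (card (col_sols (proj S (u - mat 1)) i l))"
  using assms
  by (simp add: arc_char_col_sols uproj_UT_UNIV uproj_minus_one proj_entry theta_zero)

lemma arc_char_uproj_no_col:
  assumes "i < l" "a \<noteq> 0" "u \<in> UT UNIV" "l \<notin> S"
  shows "arc_char \<theta> i a l (uproj S u) = of_nat (card (row_sols (proj S (u - mat 1)) i l))"
  using assms
  by (simp add: arc_char_row_sols uproj_UT_UNIV uproj_minus_one proj_entry theta_zero)

text \<open>If row \<open>i\<close> of \<open>u - 1\<close> is, on \<open>{i<..<l}\<close>, a combination of the rows below it, then row operations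
  remove it from the block of a shorter arc starting at \<open>i\<close>.\<close>

lemma arc_char_row_removable:
  assumes "i < k" "k < l" "a \<noteq> 0" "u \<in> UT UNIV"
    and s: "s \<in> row_sols (u - mat 1) i l"
  shows "arc_char \<theta> i a k u = of_nat (card (col_sols (u - mat 1) i k))"
proof -
  define X where "X = u - mat 1"
  have X: "X \<in> nil_alg UNIV" using assms(4) by (simp add: X_def UT_iff)
  have sX: "s \<in> pivot_vecs i {i<..<l}" "\<And>q. q \<in> {i<..<l} \<Longrightarrow> (\<Sum>p\<in>UNIV. s p * X $ p $ q) = 0"
    using s unfolding row_sols_def X_def by blast+
  have "(\<Sum>q\<in>UNIV. X $ i $ q * t q) = 0" if t: "t \<in> col_sols X i k" for t
  proof -
    have tk: "t q = 0" if "q \<notin> {i<..k}" for q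
      using t that col_vec_zero[of t k i q] assms(1) unfolding col_sols_def by blast
    \<comment> \<open>For \<open>p \<ge> k\<close> the row \<open>p\<close> of \<open>X\<close> has no entries in the support of \<open>t\<close>.\<close>
    have below: "(\<Sum>q\<in>UNIV. X $ p $ q * t q) = 0" if "p \<in> {i<..<l}" for p
    proof (cases "p < k")
      case True
      then show ?thesis using t that unfolding col_sols_def by simp
    next
      case False
      show ?thesis
      proof (rule sum.neutral, rule ballI)
        fix q
        have "t q = 0" if "X $ p $ q \<noteq> 0"
          using that X False unfolding mem_nil_alg by (intro tk) force
        then show "X $ p $ q * t q = 0" by auto
      qed
    qed
    have "(\<Sum>q\<in>UNIV. X $ i $ q * t q) = (\<Sum>p\<in>UNIV. s p * (\<Sum>q\<in>UNIV. X $ p $ q * t q))"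
      using pivot_sum[OF sX(1), of "\<lambda>p. \<Sum>q\<in>UNIV. X $ p $ q * t q"] below by simp
    also have "\<dots> = (\<Sum>q\<in>UNIV. (\<Sum>p\<in>UNIV. s p * X $ p $ q) * t q)"
      unfolding sum_distrib_left sum_distrib_right by (subst sum.swap) (simp add: mult.assoc)
    also have "\<dots> = 0"
    proof (rule sum.neutral, rule ballI)
      fix q
      show "(\<Sum>p\<in>UNIV. s p * X $ p $ q) * t q = 0"
        using sX(2)[of q] tk[of q] assms(2) by (cases "q \<in> {i<..k}") auto
    qed
    finally show ?thesis .
  qed
  then show ?thesis
    using assms by (simp add: arc_char_col_sols theta_zero X_def)
qed

text \<open>In the same way, a column \<open>l\<close> of \<open>u - 1\<close> that is, on \<open>{i<..<l}\<close>, a combination of the columns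
  before it is removed by column operations from the block of a shorter arc ending at \<open>l\<close>.\<close>

lemma arc_char_col_removable:
  assumes "i < j" "j < l" "b \<noteq> 0" "u \<in> UT UNIV"
    and t: "t \<in> col_sols (u - mat 1) i l"
  shows "arc_char \<theta> j b l u = of_nat (card (row_sols (u - mat 1) j l))"
proof -
  define X where "X = u - mat 1"
  have X: "X \<in> nil_alg UNIV" using assms(4) by (simp add: X_def UT_iff)
  have tX: "t \<in> pivot_vecs l {i<..<l}" "\<And>p. p \<in> {i<..<l} \<Longrightarrow> (\<Sum>q\<in>UNIV. X $ p $ q * t q) = 0"
    using t unfolding col_sols_def X_def by blast+
  have "(\<Sum>p\<in>UNIV. s p * X $ p $ l) = 0" if s: "s \<in> row_sols X j l" for s
  proof -
    have sj: "s p = 0" if "p \<notin> {j..<l}" for p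
      using s that row_vec_zero[of s j l p] assms(2) unfolding row_sols_def by blast
    \<comment> \<open>For \<open>q \<le> j\<close> the column \<open>q\<close> of \<open>X\<close> has no entries in the support of \<open>s\<close>.\<close>
    have before: "(\<Sum>p\<in>UNIV. s p * X $ p $ q) = 0" if "q \<in> {i<..<l}" for q
    proof (cases "j < q")
      case True
      then show ?thesis using s that unfolding row_sols_def by simp
    next
      case False
      show ?thesis
      proof (rule sum.neutral, rule ballI)
        fix p
        have "s p = 0" if "X $ p $ q \<noteq> 0"
          using that X False unfolding mem_nil_alg by (intro sj) force
        then show "s p * X $ p $ q = 0" by auto
      qed
    qed
    have "(\<Sum>p\<in>UNIV. s p * X $ p $ l) = (\<Sum>q\<in>UNIV. t q * (\<Sum>p\<in>UNIV. s p * X $ p $ q))"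
      using pivot_sum[OF tX(1), of "\<lambda>q. \<Sum>p\<in>UNIV. s p * X $ p $ q"] before by simp
    also have "\<dots> = (\<Sum>p\<in>UNIV. s p * (\<Sum>q\<in>UNIV. X $ p $ q * t q))"
      unfolding sum_distrib_left by (subst sum.swap) (simp add: ac_simps)
    also have "\<dots> = 0"
    proof (rule sum.neutral, rule ballI)
      fix p
      show "s p * (\<Sum>q\<in>UNIV. X $ p $ q * t q) = 0"
        using tX(2)[of p] sj[of p] order.strict_trans2[OF assms(1), of p]
        by (cases "p \<in> {j..<l}") auto
    qed
    finally show ?thesis .
  qed
  then show ?thesis
    using assms by (simp add: arc_char_row_sols theta_zero X_def)
qed

section \<open>Products of two arcs\<close>

text \<open>The character of the longer arc vanishes at \<open>u\<close> unless the shorter arc can do without row \<open>i\<close>.\<close>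

lemma arc_prod_same_start:
  assumes "i < k" "k < l" "a \<noteq> 0" "b \<noteq> 0" "u \<in> UT UNIV"
  shows "arc_char \<theta> i a k u * arc_char \<theta> i b l u =
    arc_char \<theta> i a k (uproj {i<..l} u) * arc_char \<theta> i b l u"
proof (cases "row_sols (u - mat 1) i l = {}")
  case True
  then have "arc_char \<theta> i b l u = 0"
    using assms by (intro arc_char_inconsistent) auto
  then show ?thesis by simp
next
  case False
  then obtain s where "s \<in> row_sols (u - mat 1) i l" by blast
  then have "arc_char \<theta> i a k u = of_nat (card (col_sols (u - mat 1) i k))"
    using assms by (intro arc_char_row_removable)
  also have "\<dots> = arc_char \<theta> i a k (uproj {i<..l} u)"
  proof -
    have "{i<..k} \<subseteq> {i<..l}" using assms(2) by auto
    then show ?thesis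
      using assms by (simp add: arc_char_uproj_no_row col_sols_proj)
  qed
  finally show ?thesis by simp
qed

text \<open>The mirror image, with column \<open>l\<close> in place of row \<open>i\<close>.\<close>

lemma arc_prod_same_end:
  assumes "i < j" "j < l" "a \<noteq> 0" "b \<noteq> 0" "u \<in> UT UNIV"
  shows "arc_char \<theta> i a l u * arc_char \<theta> j b l u =
    arc_char \<theta> i a l u * arc_char \<theta> j b l (uproj {i..<l} u)"
proof (cases "col_sols (u - mat 1) i l = {}")
  case True
  then have "arc_char \<theta> i a l u = 0"
    using assms by (intro arc_char_inconsistent) auto
  then show ?thesis by simp
next
  case False
  then obtain t where "t \<in> col_sols (u - mat 1) i l" by blast
  then have "arc_char \<theta> j b l u = of_nat (card (row_sols (u - mat 1) j l))"
    using assms by (intro arc_char_col_removable)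
  also have "\<dots> = arc_char \<theta> j b l (uproj {i..<l} u)"
  proof -
    have "{j..<l} \<subseteq> {i..<l}" using assms(1) by auto
    then show ?thesis
      using assms by (simp add: arc_char_uproj_no_col row_sols_proj)
  qed
  finally show ?thesis by simp
qed

text \<open>The first factor is evaluated through the column solutions and the second through the row
  solutions; the phases cancel.  Deleting row \<open>i\<close> in one factor and column \<open>l\<close> in the other leaves the
  same two counts, and an inconsistent system makes one of them 0.\<close>

lemma arc_prod_opposite:
  assumes "i < l" "a \<noteq> 0" "u \<in> UT UNIV"
  shows "arc_char \<theta> i a l u * arc_char \<theta> i (- a) l u =
    arc_char \<theta> i a l (uproj {i<..l} u) * arc_char \<theta> i (- a) l (uproj {i..<l} u)"
proof -
  let ?C = "col_sols (u - mat 1) i l" and ?R = "row_sols (u - mat 1) i l"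
  have a': "- a \<noteq> 0" using assms(2) by simp
  have rhs: "arc_char \<theta> i a l (uproj {i<..l} u) = of_nat (card ?C)"
    "arc_char \<theta> i (- a) l (uproj {i..<l} u) = of_nat (card ?R)"
    using assms by (simp_all add: arc_char_uproj_no_row arc_char_uproj_no_col col_sols_proj
        row_sols_proj)
  show ?thesis
  proof (cases "?C = {} \<or> ?R = {}")
    case True
    then show ?thesis
      using arc_char_inconsistent[OF assms True] by (auto simp: rhs)
  next
    case False
    then obtain t s where t: "t \<in> ?C" and s: "s \<in> ?R" by blast
    define z where "z = (\<Sum>p\<in>UNIV. s p * (u - mat 1) $ p $ l)"
    have phases: "\<theta> (a * z) * \<theta> (- a * z) = 1"
      by (simp add: theta_zero flip: hom)
    have "arc_char \<theta> i a l u = of_nat (card ?C) * \<theta> (a * z)"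
      unfolding z_def by (rule arc_char_consistent(1)[OF assms t s])
    moreover have "arc_char \<theta> i (- a) l u = of_nat (card ?R) * \<theta> (- a * z)"
      unfolding z_def by (rule arc_char_consistent(2)[OF assms(1) a' assms(3) t s])
    ultimately have "arc_char \<theta> i a l u * arc_char \<theta> i (- a) l u =
        of_nat (card ?C) * of_nat (card ?R) * (\<theta> (a * z) * \<theta> (- a * z))"
      by (simp only: ac_simps)
    then show ?thesis
      unfolding rhs phases by simp
  qed
qed

text \<open>The phases multiply to that of \<open>a + b\<close>, and the second count of solutions is the number of
  solutions of the homogeneous system, which is what the projection to \<open>{i<..<l}\<close> contributes.\<close>

lemma arc_prod_same_arc:
  assumes "i < l" "a \<noteq> 0" "b \<noteq> 0" "a + b \<noteq> 0" "u \<in> UT UNIV"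
  shows "arc_char \<theta> i a l u * arc_char \<theta> i b l u =
    arc_char \<theta> i (a + b) l u * arc_char \<theta> i (a + b) l (uproj {i<..<l} u)"
proof (cases "col_sols (u - mat 1) i l = {} \<or> row_sols (u - mat 1) i l = {}")
  case True
  then have "arc_char \<theta> i a l u = 0" "arc_char \<theta> i (a + b) l u = 0"
    using assms by (auto intro!: arc_char_inconsistent)
  then show ?thesis by simp
next
  case False
  let ?C = "col_sols (u - mat 1) i l"
  from False obtain t s where ts: "t \<in> ?C" "s \<in> row_sols (u - mat 1) i l" by blast
  define z where "z = (\<Sum>p\<in>UNIV. s p * (u - mat 1) $ p $ l)"
  have value_at: "arc_char \<theta> i c l u = of_nat (card ?C) * \<theta> (c * z)" if "c \<noteq> 0" for c
    unfolding z_def by (rule arc_char_consistent(1)[OF assms(1) that assms(5) ts])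
  have "arc_char \<theta> i (a + b) l (uproj {i<..<l} u) = of_nat (card ?C)"
    using assms by (simp add: arc_char_uproj_no_row card_col_sols_homogeneous[OF ts(1)])
  then show ?thesis
    using assms by (simp add: value_at distrib_right hom)
qed

lemma SinfRes_arc_char:
  assumes "order_convex S" "u \<in> UT UNIV"
  shows "SinfRes \<theta> S (arc_char \<theta> i a l) u = arc_char \<theta> i a l (uproj S u)"
  using assms by (simp add: SinfRes_apply arc_char_superclass_function)

end

theorem lemma4p6:
  fixes \<theta> :: "'a::{field,finite} \<Rightarrow> complex"
    and i j k l :: "'n::{finite,linorder}"
  assumes hom: "\<And>x y. \<theta> (x + y) = \<theta> x * \<theta> y"
    and nonzero: "\<And>x. \<theta> x \<noteq> 0"
    and nontrivial: "\<exists>x. \<theta> x \<noteq> 1"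
    and "i < j" and "j < k" and "k < l"
  shows
    "(\<forall>a b. a \<noteq> 0 \<longrightarrow> b \<noteq> 0 \<longrightarrow>
        arc_char \<theta> i a k \<otimes>\<^sub>U arc_char \<theta> i b l =
        SinfRes \<theta> {i<..l} (arc_char \<theta> i a k) \<otimes>\<^sub>U arc_char \<theta> i b l) \<and>
     (\<forall>a b. a \<noteq> 0 \<longrightarrow> b \<noteq> 0 \<longrightarrow>
        arc_char \<theta> i a l \<otimes>\<^sub>U arc_char \<theta> j b l =
        arc_char \<theta> i a l \<otimes>\<^sub>U SinfRes \<theta> {i..<l} (arc_char \<theta> j b l)) \<and>
     (\<forall>a. a \<noteq> 0 \<longrightarrow>
        arc_char \<theta> i a l \<otimes>\<^sub>U arc_char \<theta> i (- a) l =
        SinfRes \<theta> {i<..l} (arc_char \<theta> i a l) \<otimes>\<^sub>U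
        SinfRes \<theta> {i..<l} (arc_char \<theta> i (- a) l)) \<and>
     (\<forall>a b. a \<noteq> 0 \<longrightarrow> b \<noteq> 0 \<longrightarrow> b \<noteq> - a \<longrightarrow>
        arc_char \<theta> i a l \<otimes>\<^sub>U arc_char \<theta> i b l =
        arc_char \<theta> i (a + b) l \<otimes>\<^sub>U SinfRes \<theta> {i<..<l} (arc_char \<theta> i (a + b) l))"
proof -
  interpret additive_character \<theta>
    using hom nonzero nontrivial by (rule additive_character.intro)
  have "i < k" and "j < l"
    using \<open>i < j\<close> \<open>j < k\<close> \<open>k < l\<close> by (blast intro: order.strict_trans)+
  with \<open>k < l\<close> have "i < l"
    by (blast intro: order.strict_trans)
  show ?thesis
  proof (intro conjI allI impI)
    fix a b :: 'a
    assume ab: "a \<noteq> 0" "b \<noteq> 0"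
    show "arc_char \<theta> i a k \<otimes>\<^sub>U arc_char \<theta> i b l =
        SinfRes \<theta> {i<..l} (arc_char \<theta> i a k) \<otimes>\<^sub>U arc_char \<theta> i b l"
      unfolding char_prod_def
      by (rule restrict_ext) (simp add: SinfRes_arc_char order_convex_intervals
          arc_prod_same_start[OF \<open>i < k\<close> \<open>k < l\<close> ab])
    show "arc_char \<theta> i a l \<otimes>\<^sub>U arc_char \<theta> j b l =
        arc_char \<theta> i a l \<otimes>\<^sub>U SinfRes \<theta> {i..<l} (arc_char \<theta> j b l)"
      unfolding char_prod_def
      by (rule restrict_ext) (simp add: SinfRes_arc_char order_convex_intervals
          arc_prod_same_end[OF \<open>i < j\<close> \<open>j < l\<close> ab])
  next
    fix a :: 'a
    assume a: "a \<noteq> 0"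
    show "arc_char \<theta> i a l \<otimes>\<^sub>U arc_char \<theta> i (- a) l =
        SinfRes \<theta> {i<..l} (arc_char \<theta> i a l) \<otimes>\<^sub>U
        SinfRes \<theta> {i..<l} (arc_char \<theta> i (- a) l)"
      unfolding char_prod_def
      by (rule restrict_ext) (simp add: SinfRes_arc_char order_convex_intervals
          arc_prod_opposite[OF \<open>i < l\<close> a])
  next
    fix a b :: 'a
    assume ab: "a \<noteq> 0" "b \<noteq> 0" and "b \<noteq> - a"
    then have "a + b \<noteq> 0"
      by (simp add: add_eq_0_iff)
    show "arc_char \<theta> i a l \<otimes>\<^sub>U arc_char \<theta> i b l =
        arc_char \<theta> i (a + b) l \<otimes>\<^sub>U SinfRes \<theta> {i<..<l} (arc_char \<theta> i (a + b) l)"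
      unfolding char_prod_def
      by (rule restrict_ext) (simp add: SinfRes_arc_char order_convex_intervals
          arc_prod_same_arc[OF \<open>i < l\<close> ab \<open>a + b \<noteq> 0\<close>])
  qed
qed

end
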